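(* Let $\Bbbk$ be an algebraically closed field of characteristic zero, and let $\omega\in\Bbbk$ be a fixed primitive $6$-th root of unity. Consider the following four $12$-dimensional pointed nonsemisimple Hopf algebras over $\Bbbk$, each generated as an algebra by $g$ and $x$ subject to the listed relations, with the listed comultiplication: $$\mathcal{A}_0:\ g^6=1,\ x^2=0,\ gx=-xg,\ \Delta(g)=g\otimes g,\ \Delta(x)=x\otimes1+g\otimes x;$$ $$\mathcal{A}_1:\ g^6=1,\ x^2=1-g^2,\ gx=-xg,\ \Delta(g)=g\otimes g,\ \Delta(x)=x\otimes1+g\otimes x;$$ $$\mathcal{B}_0:\ g^6=1,\ x^2=0,\ gx=-xg,\ \Delta(g)=g\otimes g,\ \Delta(x)=x\otimes1+g^3\otimes x;$$ $$\mathcal{B}_1:\ g^6=1,\ x^2=0,\ gx=\omega xg,\ \Delta(g)=g\otimes g,\ \Delta(x)=x\otimes1+g^3\otimes x.$$ Then $\mathcal{A}_0$, $\mathcal{A}_1$, $\mathcal{B}_0$ and $\mathcal{B}_1$ are mutually not gauge equivalent.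
   Context: Two finite-dimensional Hopf algebras over $\Bbbk$ are gauge equivalent if their categories of finite-dimensional left modules are equivalent as ($\Bbbk$-linear) tensor categories. In each of the four Hopf algebras the counit is determined by $\varepsilon(g)=1$, $\varepsilon(x)=0$. These four Hopf algebras are, up to isomorphism, all the pointed nonsemisimple Hopf algebras of dimension $12$ over $\Bbbk$. *)

theory Defs
  imports
    "HOL-Analysis.Analysis"
    "HOL-Library.Poly_Mapping"
    "Jordan_Normal_Form.Matrix"
begin

no_notation vec_index (infixl "$" 100)
hide_const (open) Finite_Cartesian_Product.mat


section \<open>Finite-dimensional Hopf algebras\<close>

text \<open>
  The underlying space of a finite-dimensional Hopf algebra is written in coordinates as
  \<open>'k^'b\<close>, where the finite type \<open>'b\<close> indexes a basis; then \<open>H \<otimes> H\<close> is \<open>'k^('b \<times> 'b)\<close>.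
\<close>

definition tens :: "'k::field^'b \<Rightarrow> 'k^'c \<Rightarrow> 'k^('b \<times> 'c)" (infixr "\<otimes>\<^sub>v" 75)
  where "a \<otimes>\<^sub>v b = (\<chi> p. a $ fst p * b $ snd p)"

text \<open>The linear map on a tensor product that is induced by a bilinear map \<open>\<beta>\<close>.\<close>

definition tlift :: "('k::field^'b::finite \<Rightarrow> 'k^'c::finite \<Rightarrow> 'k^'d) \<Rightarrow> 'k^('b \<times> 'c) \<Rightarrow> 'k^'d"
  where "tlift \<beta> t = (\<Sum>p\<in>UNIV. t $ p *s \<beta> (axis (fst p) 1) (axis (snd p) 1))"

record ('k, 'b) hopf =
  hmult :: "'k^'b \<Rightarrow> 'k^'b \<Rightarrow> 'k^'b"
  hunit :: "'k^'b"
  comult :: "'k^'b \<Rightarrow> 'k^('b \<times> 'b)"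
  counit :: "'k^'b \<Rightarrow> 'k"
  antipode :: "'k^'b \<Rightarrow> 'k^'b"

definition is_algebra :: "('k::field, 'b::finite) hopf \<Rightarrow> bool" where
  "is_algebra H \<longleftrightarrow>
     (\<forall>a. Vector_Spaces.linear (*s) (*s) (\<lambda>b. hmult H a b)) \<and>
     (\<forall>b. Vector_Spaces.linear (*s) (*s) (\<lambda>a. hmult H a b)) \<and>
     (\<forall>a b c. hmult H (hmult H a b) c = hmult H a (hmult H b c)) \<and>
     (\<forall>a. hmult H (hunit H) a = a \<and> hmult H a (hunit H) = a)"

definition is_coalgebra :: "('k::field, 'b::finite) hopf \<Rightarrow> bool" where
  "is_coalgebra H \<longleftrightarrow>
     Vector_Spaces.linear (*s) (*s) (comult H) \<and>
     Vector_Spaces.linear (*s) (*) (counit H) \<and>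
     (\<forall>a i j k. tlift (\<lambda>b c. comult H b \<otimes>\<^sub>v c) (comult H a) $ ((i, j), k) =
                tlift (\<lambda>b c. b \<otimes>\<^sub>v comult H c) (comult H a) $ (i, (j, k))) \<and>
     (\<forall>a. tlift (\<lambda>b c. counit H b *s c) (comult H a) = a \<and>
          tlift (\<lambda>b c. counit H c *s b) (comult H a) = a)"

definition tmult :: "('k::field, 'b::finite) hopf \<Rightarrow> 'k^('b \<times> 'b) \<Rightarrow> 'k^('b \<times> 'b) \<Rightarrow> 'k^('b \<times> 'b)"
  where "tmult H s t = tlift (\<lambda>a b. tlift (\<lambda>c d. hmult H a c \<otimes>\<^sub>v hmult H b d) t) s"

definition is_hopf_algebra :: "('k::field, 'b::finite) hopf \<Rightarrow> bool" where
  "is_hopf_algebra H \<longleftrightarrow>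
     is_algebra H \<and> is_coalgebra H \<and>
     (\<forall>a b. comult H (hmult H a b) = tmult H (comult H a) (comult H b)) \<and>
     comult H (hunit H) = hunit H \<otimes>\<^sub>v hunit H \<and>
     (\<forall>a b. counit H (hmult H a b) = counit H a * counit H b) \<and>
     counit H (hunit H) = 1 \<and>
     Vector_Spaces.linear (*s) (*s) (antipode H) \<and>
     (\<forall>a. tlift (\<lambda>b c. hmult H (antipode H b) c) (comult H a) = counit H a *s hunit H \<and>
          tlift (\<lambda>b c. hmult H b (antipode H c)) (comult H a) = counit H a *s hunit H)"


section \<open>Generators and relations\<close>

datatype 'x word = Word (letters: "'x list")

instantiation word :: (type) monoid_add
begin

definition zero_word :: "'a word" where "0 = Word []"
definition plus_word :: "'a word \<Rightarrow> 'a word \<Rightarrow> 'a word"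
  where "u + v = Word (letters u @ letters v)"

instance
  by standard (auto simp: zero_word_def plus_word_def)

end

text \<open>
  With concatenation as (noncommutative) addition of words, the convolution product makes
  \<open>'x word \<Rightarrow>\<^sub>0 'k\<close> the free associative unital \<open>'k\<close>-algebra on \<open>'x\<close>.
\<close>

type_synonym ('k, 'x) free_algebra = "'x word \<Rightarrow>\<^sub>0 'k"

definition gen :: "'x \<Rightarrow> ('k::field, 'x) free_algebra"
  where "gen i = Poly_Mapping.single (Word [i]) 1"

definition scalar :: "'k::field \<Rightarrow> ('k, 'x) free_algebra"
  where "scalar c = Poly_Mapping.single 0 c"

definition eval_word :: "('k::field, 'b::finite) hopf \<Rightarrow> ('x \<Rightarrow> 'k^'b) \<Rightarrow> 'x word \<Rightarrow> 'k^'b"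
  where "eval_word H v w = foldr (\<lambda>i a. hmult H (v i) a) (letters w) (hunit H)"

definition free_eval ::
    "('k::field, 'b::finite) hopf \<Rightarrow> ('x \<Rightarrow> 'k^'b) \<Rightarrow> ('k, 'x) free_algebra \<Rightarrow> 'k^'b"
  where "free_eval H v p =
    (\<Sum>w\<in>Poly_Mapping.keys p. Poly_Mapping.lookup p w *s eval_word H v w)"

inductive_set ideal_gen :: "'r::ring_1 set \<Rightarrow> 'r set" for R :: "'r set" where
  base: "r \<in> R \<Longrightarrow> r \<in> ideal_gen R"
| zero: "0 \<in> ideal_gen R"
| add: "r \<in> ideal_gen R \<Longrightarrow> s \<in> ideal_gen R \<Longrightarrow> r + s \<in> ideal_gen R"
| left: "r \<in> ideal_gen R \<Longrightarrow> a * r \<in> ideal_gen R"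
| right: "r \<in> ideal_gen R \<Longrightarrow> r * a \<in> ideal_gen R"

text \<open>The evaluation map identifies \<open>H\<close> with the free algebra modulo the relators \<open>R\<close>.\<close>

definition presented_by ::
    "('k::field, 'b::finite) hopf \<Rightarrow> ('x \<Rightarrow> 'k^'b) \<Rightarrow> ('k, 'x) free_algebra set \<Rightarrow> bool"
  where "presented_by H v R \<longleftrightarrow>
    surj (free_eval H v) \<and> (\<forall>p. free_eval H v p = 0 \<longleftrightarrow> p \<in> ideal_gen R)"


section \<open>The four Hopf algebras\<close>

datatype gx = Gg | Gx

abbreviation (input) fG :: "('k::field, gx) free_algebra" where "fG \<equiv> gen Gg"
abbreviation (input) fX :: "('k::field, gx) free_algebra" where "fX \<equiv> gen Gx"

definition gx_hopf ::
    "('k::field, 'b::finite) hopf \<Rightarrow> 'k^'b \<Rightarrow> 'k^'b \<Rightarrow> ('k, gx) free_algebra set \<Rightarrow> bool"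
  where "gx_hopf H g x R \<longleftrightarrow>
    is_hopf_algebra H \<and> CARD('b) = 12 \<and>
    presented_by H (\<lambda>i. case i of Gg \<Rightarrow> g | Gx \<Rightarrow> x) R \<and>
    counit H g = 1 \<and> counit H x = 0"

definition is_A0 :: "('k::field, 'b::finite) hopf \<Rightarrow> 'k^'b \<Rightarrow> 'k^'b \<Rightarrow> bool" where
  "is_A0 H g x \<longleftrightarrow>
     gx_hopf H g x {fG ^ 6 - 1, fX ^ 2, fG * fX - (- fX * fG)} \<and>
     comult H g = g \<otimes>\<^sub>v g \<and>
     comult H x = x \<otimes>\<^sub>v hunit H + g \<otimes>\<^sub>v x"

definition is_A1 :: "('k::field, 'b::finite) hopf \<Rightarrow> 'k^'b \<Rightarrow> 'k^'b \<Rightarrow> bool" where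
  "is_A1 H g x \<longleftrightarrow>
     gx_hopf H g x {fG ^ 6 - 1, fX ^ 2 - (1 - fG ^ 2), fG * fX - (- fX * fG)} \<and>
     comult H g = g \<otimes>\<^sub>v g \<and>
     comult H x = x \<otimes>\<^sub>v hunit H + g \<otimes>\<^sub>v x"

definition is_B0 :: "('k::field, 'b::finite) hopf \<Rightarrow> 'k^'b \<Rightarrow> 'k^'b \<Rightarrow> bool" where
  "is_B0 H g x \<longleftrightarrow>
     gx_hopf H g x {fG ^ 6 - 1, fX ^ 2, fG * fX - (- fX * fG)} \<and>
     comult H g = g \<otimes>\<^sub>v g \<and>
     comult H x = x \<otimes>\<^sub>v hunit H + hmult H g (hmult H g g) \<otimes>\<^sub>v x"

definition is_B1 :: "'k::field \<Rightarrow> ('k, 'b::finite) hopf \<Rightarrow> 'k^'b \<Rightarrow> 'k^'b \<Rightarrow> bool" where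
  "is_B1 \<omega> H g x \<longleftrightarrow>
     gx_hopf H g x {fG ^ 6 - 1, fX ^ 2, fG * fX - scalar \<omega> * fX * fG} \<and>
     comult H g = g \<otimes>\<^sub>v g \<and>
     comult H x = x \<otimes>\<^sub>v hunit H + hmult H g (hmult H g g) \<otimes>\<^sub>v x"

definition primitive_root_of_unity :: "nat \<Rightarrow> 'k::field \<Rightarrow> bool" where
  "primitive_root_of_unity n w \<longleftrightarrow> 0 < n \<and> w ^ n = 1 \<and> (\<forall>m. 0 < m \<and> m < n \<longrightarrow> w ^ m \<noteq> 1)"


section \<open>Linear monoidal categories and their equivalences\<close>

text \<open>
  Hom-sets need not be disjoint. \<open>Comp C g f\<close> is \<open>g \<circ> f\<close>, and
  \<open>Assoc C X Y Z\<close> goes from \<open>(X \<otimes> Y) \<otimes> Z\<close> to \<open>X \<otimes> (Y \<otimes> Z)\<close>.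
\<close>

record ('o, 'm, 'k) lin_moncat =
  Obj :: "'o set"
  Hom :: "'o \<Rightarrow> 'o \<Rightarrow> 'm set"
  Id :: "'o \<Rightarrow> 'm"
  Comp :: "'m \<Rightarrow> 'm \<Rightarrow> 'm"
  Add :: "'m \<Rightarrow> 'm \<Rightarrow> 'm"
  Scale :: "'k \<Rightarrow> 'm \<Rightarrow> 'm"
  TensO :: "'o \<Rightarrow> 'o \<Rightarrow> 'o"
  TensM :: "'m \<Rightarrow> 'm \<Rightarrow> 'm"
  UnitO :: "'o"
  Assoc :: "'o \<Rightarrow> 'o \<Rightarrow> 'o \<Rightarrow> 'm"
  LUnit :: "'o \<Rightarrow> 'm"
  RUnit :: "'o \<Rightarrow> 'm"

definition is_iso :: "('o, 'm, 'k) lin_moncat \<Rightarrow> 'o \<Rightarrow> 'o \<Rightarrow> 'm \<Rightarrow> bool" where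
  "is_iso C X Y f \<longleftrightarrow> f \<in> Hom C X Y \<and>
     (\<exists>f'\<in>Hom C Y X. Comp C f' f = Id C X \<and> Comp C f f' = Id C Y)"

record ('o, 'm, 'p, 'n) fctr =
  fobj :: "'o \<Rightarrow> 'p"
  fmor :: "'o \<Rightarrow> 'o \<Rightarrow> 'm \<Rightarrow> 'n"

definition is_fctr ::
    "('o, 'm, 'k) lin_moncat \<Rightarrow> ('p, 'n, 'k) lin_moncat \<Rightarrow> ('o, 'm, 'p, 'n) fctr \<Rightarrow> bool" where
  "is_fctr C D F \<longleftrightarrow>
     (\<forall>X\<in>Obj C. fobj F X \<in> Obj D) \<and>
     (\<forall>X\<in>Obj C. \<forall>Y\<in>Obj C. \<forall>f\<in>Hom C X Y. fmor F X Y f \<in> Hom D (fobj F X) (fobj F Y)) \<and>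
     (\<forall>X\<in>Obj C. fmor F X X (Id C X) = Id D (fobj F X)) \<and>
     (\<forall>X\<in>Obj C. \<forall>Y\<in>Obj C. \<forall>Z\<in>Obj C. \<forall>f\<in>Hom C X Y. \<forall>g\<in>Hom C Y Z.
        fmor F X Z (Comp C g f) = Comp D (fmor F Y Z g) (fmor F X Y f))"

definition is_linear_fctr ::
    "('o, 'm, 'k) lin_moncat \<Rightarrow> ('p, 'n, 'k) lin_moncat \<Rightarrow> ('o, 'm, 'p, 'n) fctr \<Rightarrow> bool" where
  "is_linear_fctr C D F \<longleftrightarrow> is_fctr C D F \<and>
     (\<forall>X\<in>Obj C. \<forall>Y\<in>Obj C. \<forall>f\<in>Hom C X Y. \<forall>g\<in>Hom C X Y.
        fmor F X Y (Add C f g) = Add D (fmor F X Y f) (fmor F X Y g)) \<and>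
     (\<forall>X\<in>Obj C. \<forall>Y\<in>Obj C. \<forall>f\<in>Hom C X Y. \<forall>c.
        fmor F X Y (Scale C c f) = Scale D c (fmor F X Y f))"

definition id_fctr :: "('o, 'm, 'o, 'm) fctr"
  where "id_fctr = \<lparr>fobj = (\<lambda>X. X), fmor = (\<lambda>X Y f. f)\<rparr>"

definition comp_fctr ::
    "('p, 'n, 'q, 'l) fctr \<Rightarrow> ('o, 'm, 'p, 'n) fctr \<Rightarrow> ('o, 'm, 'q, 'l) fctr"
  where "comp_fctr G F =
    \<lparr>fobj = (\<lambda>X. fobj G (fobj F X)),
     fmor = (\<lambda>X Y f. fmor G (fobj F X) (fobj F Y) (fmor F X Y f))\<rparr>"

definition is_nat_iso ::
    "('o, 'm, 'k) lin_moncat \<Rightarrow> ('p, 'n, 'k) lin_moncat \<Rightarrow>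
     ('o, 'm, 'p, 'n) fctr \<Rightarrow> ('o, 'm, 'p, 'n) fctr \<Rightarrow> ('o \<Rightarrow> 'n) \<Rightarrow> bool" where
  "is_nat_iso C D F G \<eta> \<longleftrightarrow>
     (\<forall>X\<in>Obj C. is_iso D (fobj F X) (fobj G X) (\<eta> X)) \<and>
     (\<forall>X\<in>Obj C. \<forall>Y\<in>Obj C. \<forall>f\<in>Hom C X Y.
        Comp D (\<eta> Y) (fmor F X Y f) = Comp D (fmor G X Y f) (\<eta> X))"

definition is_equivalence ::
    "('o, 'm, 'k) lin_moncat \<Rightarrow> ('p, 'n, 'k) lin_moncat \<Rightarrow> ('o, 'm, 'p, 'n) fctr \<Rightarrow> bool" where
  "is_equivalence C D F \<longleftrightarrow> is_fctr C D F \<and>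
     (\<exists>G \<eta> \<theta>. is_fctr D C G \<and>
        is_nat_iso C C (comp_fctr G F) id_fctr \<eta> \<and>
        is_nat_iso D D (comp_fctr F G) id_fctr \<theta>)"

text \<open>
  A (strong) monoidal structure on \<open>F\<close>: isomorphisms
  \<open>J X Y : F X \<otimes> F Y \<rightarrow> F (X \<otimes> Y)\<close>, natural in both variables, and \<open>\<phi> : 1 \<rightarrow> F 1\<close>,
  compatible with the associativity and unit constraints.
\<close>

definition is_monoidal_structure ::
    "('o, 'm, 'k) lin_moncat \<Rightarrow> ('p, 'n, 'k) lin_moncat \<Rightarrow> ('o, 'm, 'p, 'n) fctr \<Rightarrow>
     ('o \<Rightarrow> 'o \<Rightarrow> 'n) \<Rightarrow> 'n \<Rightarrow> bool" where
  "is_monoidal_structure C D F J \<phi> \<longleftrightarrow>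
     (\<forall>X\<in>Obj C. \<forall>Y\<in>Obj C.
        is_iso D (TensO D (fobj F X) (fobj F Y)) (fobj F (TensO C X Y)) (J X Y)) \<and>
     (\<forall>X\<in>Obj C. \<forall>X'\<in>Obj C. \<forall>Y\<in>Obj C. \<forall>Y'\<in>Obj C. \<forall>f\<in>Hom C X X'. \<forall>g\<in>Hom C Y Y'.
        Comp D (J X' Y') (TensM D (fmor F X X' f) (fmor F Y Y' g)) =
        Comp D (fmor F (TensO C X Y) (TensO C X' Y') (TensM C f g)) (J X Y)) \<and>
     is_iso D (UnitO D) (fobj F (UnitO C)) \<phi> \<and>
     (\<forall>X\<in>Obj C. \<forall>Y\<in>Obj C. \<forall>Z\<in>Obj C.
        Comp D (fmor F (TensO C (TensO C X Y) Z) (TensO C X (TensO C Y Z)) (Assoc C X Y Z))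
          (Comp D (J (TensO C X Y) Z) (TensM D (J X Y) (Id D (fobj F Z)))) =
        Comp D (J X (TensO C Y Z))
          (Comp D (TensM D (Id D (fobj F X)) (J Y Z)) (Assoc D (fobj F X) (fobj F Y) (fobj F Z)))) \<and>
     (\<forall>X\<in>Obj C.
        Comp D (fmor F (TensO C (UnitO C) X) X (LUnit C X))
          (Comp D (J (UnitO C) X) (TensM D \<phi> (Id D (fobj F X)))) = LUnit D (fobj F X)) \<and>
     (\<forall>X\<in>Obj C.
        Comp D (fmor F (TensO C X (UnitO C)) X (RUnit C X))
          (Comp D (J X (UnitO C)) (TensM D (Id D (fobj F X)) \<phi>)) = RUnit D (fobj F X))"

definition tensor_equivalent :: "('o, 'm, 'k) lin_moncat \<Rightarrow> ('p, 'n, 'k) lin_moncat \<Rightarrow> bool" where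
  "tensor_equivalent C D \<longleftrightarrow>
     (\<exists>F J \<phi>. is_linear_fctr C D F \<and> is_equivalence C D F \<and> is_monoidal_structure C D F J \<phi>)"


section \<open>The tensor category of finite-dimensional left modules\<close>

text \<open>
  Every finite-dimensional left module is isomorphic to one whose underlying space is \<open>'k\<^sup>n\<close>;
  such a module is given by the pair \<open>(n, \<rho>)\<close> where \<open>\<rho> a\<close> is the matrix of the action of \<open>a\<close>.
\<close>

type_synonym ('k, 'b) lmod = "nat \<times> ('k^'b \<Rightarrow> 'k Matrix.mat)"

definition is_left_module :: "('k::field, 'b::finite) hopf \<Rightarrow> ('k, 'b) lmod \<Rightarrow> bool" where
  "is_left_module H V \<longleftrightarrow> (case V of (n, \<rho>) \<Rightarrow>
     (\<forall>a. \<rho> a \<in> carrier_mat n n) \<and>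
     (\<forall>a b. \<rho> (a + b) = \<rho> a + \<rho> b) \<and>
     (\<forall>c a. \<rho> (c *s a) = c \<cdot>\<^sub>m \<rho> a) \<and>
     (\<forall>a b. \<rho> (hmult H a b) = \<rho> a * \<rho> b) \<and>
     \<rho> (hunit H) = 1\<^sub>m n)"

definition module_hom :: "('k::field, 'b::finite) lmod \<Rightarrow> ('k, 'b) lmod \<Rightarrow> 'k Matrix.mat set" where
  "module_hom V W = {f \<in> carrier_mat (fst W) (fst V). \<forall>a. f * snd V a = snd W a * f}"

text \<open>
  Kronecker product: the matrix of \<open>A \<otimes> B\<close>, where \<open>e\<^sub>i \<otimes> e\<^sub>j\<close> is the basis vector with
  number \<open>i * n + j\<close> of \<open>'k\<^sup>m \<otimes> 'k\<^sup>n = 'k\<^bsup>m * n\<^esup>\<close>.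
\<close>

definition kron :: "'k::field Matrix.mat \<Rightarrow> 'k Matrix.mat \<Rightarrow> 'k Matrix.mat" where
  "kron A B = Matrix.mat (dim_row A * dim_row B) (dim_col A * dim_col B)
     (\<lambda>(i, j). A $$ (i div dim_row B, j div dim_col B) * B $$ (i mod dim_row B, j mod dim_col B))"

text \<open>An element \<open>a\<close> acts on \<open>V \<otimes> W\<close> by \<open>(\<rho> \<otimes> \<sigma>) (\<Delta> a)\<close>.\<close>

definition tensor_module ::
    "('k::field, 'b::finite) hopf \<Rightarrow> ('k, 'b) lmod \<Rightarrow> ('k, 'b) lmod \<Rightarrow> ('k, 'b) lmod" where
  "tensor_module H V W = (fst V * fst W, \<lambda>a. Matrix.mat (fst V * fst W) (fst V * fst W)
     (\<lambda>ij. \<Sum>p\<in>UNIV. comult H a $ p * kron (snd V (axis (fst p) 1)) (snd W (axis (snd p) 1)) $$ ij))"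

definition trivial_module :: "('k::field, 'b::finite) hopf \<Rightarrow> ('k, 'b) lmod" where
  "trivial_module H = (1, \<lambda>a. counit H a \<cdot>\<^sub>m 1\<^sub>m 1)"

text \<open>
  In the bases above the canonical isomorphisms \<open>(U \<otimes> V) \<otimes> W \<cong> U \<otimes> (V \<otimes> W)\<close>,
  \<open>1 \<otimes> V \<cong> V\<close> and \<open>V \<otimes> 1 \<cong> V\<close> are identity matrices.
\<close>

definition rep_cat ::
    "('k::field, 'b::finite) hopf \<Rightarrow> (('k, 'b) lmod, 'k Matrix.mat, 'k) lin_moncat" where
  "rep_cat H =
     \<lparr>Obj = {V. is_left_module H V},
      Hom = module_hom,
      Id = (\<lambda>V. 1\<^sub>m (fst V)),
      Comp = (\<lambda>g f. g * f),
      Add = (\<lambda>f g. f + g),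
      Scale = (\<lambda>c f. c \<cdot>\<^sub>m f),
      TensO = tensor_module H,
      TensM = kron,
      UnitO = trivial_module H,
      Assoc = (\<lambda>U V W. 1\<^sub>m (fst U * fst V * fst W)),
      LUnit = (\<lambda>V. 1\<^sub>m (fst V)),
      RUnit = (\<lambda>V. 1\<^sub>m (fst V))\<rparr>"

definition gauge_equivalent ::
    "('k::field, 'b::finite) hopf \<Rightarrow> ('k, 'c::finite) hopf \<Rightarrow> bool" where
  "gauge_equivalent H K \<longleftrightarrow> tensor_equivalent (rep_cat H) (rep_cat K)"

end

theory Submission
  imports Defs
begin

text \<open>
  Three invariants of the tensor category separate the four algebras. Write \<open>\<chi>\<^sub>\<kappa>\<close> for the
  one-dimensional module on which \<open>g\<close> acts by \<open>\<kappa>\<close> and \<open>x\<close> by \<open>0\<close>.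

  The algebras \<open>A\<^sub>0\<close>, \<open>B\<^sub>0\<close> and \<open>B\<^sub>1\<close> can be treated together, as the cases
  \<open>(c, N) = (-1, 1)\<close>, \<open>(-1, 3)\<close>, \<open>(\<omega>, 3)\<close> of the relation \<open>g x = c x g\<close> and the coproduct
  \<open>\<Delta> x = x \<otimes> 1 + g\<^sup>N \<otimes> x\<close> (locale \<open>skew_hopf\<close>). Over them \<open>\<chi>\<^sub>\<kappa>\<close> exists for every sixth root
  of unity \<open>\<kappa>\<close>, and there is a two-dimensional module \<open>P\<close> that is a nonsplit extension of the
  trivial module \<open>1\<close> by \<open>\<chi>\<^sub>c\<close>.

  \<^item> A nontrivial object whose tensor cube is isomorphic to \<open>1\<close> exists in these three cases (a
    character of order three), but not over \<open>A\<^sub>1\<close>: there such an object is one-dimensional, so that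
    \<open>x = 0\<close> and \<open>g\<^sup>2 = 1\<close> on it, while \<open>g\<^sup>3 = 1\<close>
    (\<open>has_order_3_objectI\<close>, \<open>not_has_order_3_object\<close>).

  \<^item> An invertible object \<open>X\<close> whose tensor square is not isomorphic to \<open>1\<close> may lie in the same
    block as \<open>1\<close>, as witnessed by an object \<open>Q\<close> with scalar endomorphisms and nonzero maps
    \<open>X \<rightarrow> Q \<rightarrow> 1\<close>. Over \<open>B\<^sub>1\<close> this happens for \<open>X = \<chi>\<^sub>\<omega>\<close> and \<open>Q = P\<close>. It is impossible if
    \<open>c\<^sup>2 = 1\<close>, because \<open>g\<^sup>2\<close> is then central and separates the blocks
    (\<open>has_linked_invertibleI\<close>, \<open>not_has_linked_invertible\<close>).

  \<^item> Over \<open>B\<^sub>0\<close> the modules \<open>V \<otimes> T\<close> and \<open>T \<otimes> V\<close> are equal for every \<open>V\<close> and every character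
    \<open>T\<close> of order three. An equivalence \<open>F\<close> from the modules over \<open>A\<^sub>0\<close> to those over \<open>B\<^sub>0\<close> would
    pull this back to a half-braiding \<open>V \<otimes> \<chi>\<^sub>\<kappa> \<rightarrow> \<chi>\<^sub>\<kappa> \<otimes> V\<close>, where \<open>\<kappa>\<close> is a primitive third root of
    unity. For \<open>V = P\<close> every such module map is a multiple of \<open>diag(1, \<kappa>)\<close>; so by naturality the
    half-braidings for the two composition factors \<open>1\<close> and \<open>\<chi>\<^bsub>-1\<^esub>\<close> of \<open>P\<close> differ by the factor
    \<open>\<kappa>\<close>. On characters, however, the half-braiding is the commutator of the two-cocycle to which the
    monoidal structure of \<open>F\<close> amounts; it is multiplicative, hence \<open>1\<close> at \<open>1\<close> and \<open>\<plusminus>1\<close> at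
    \<open>\<chi>\<^bsub>-1\<^esub>\<close>. Therefore \<open>\<kappa>\<^sup>2 = 1\<close>, a contradiction
    (\<open>no_tensor_equivalence_exponents_1_3\<close>).
\<close>

section \<open>Matrices and Kronecker products\<close>

lemma sum_div_mod:
  fixes f :: "nat \<Rightarrow> nat \<Rightarrow> 'a::comm_monoid_add"
  shows "(\<Sum>k<m * n. f (k div n) (k mod n)) = (\<Sum>i<m. \<Sum>j<n. f i j)"
proof -
  have "(\<Sum>k<m * n. f (k div n) (k mod n)) =
      (\<Sum>i<m. sum (\<lambda>k. f (k div n) (k mod n)) {i * n..<i * n + n})"
    by (rule sum.nat_group[symmetric])
  also have "\<dots> = (\<Sum>i<m. \<Sum>j<n. f i j)"
  proof (rule sum.cong[OF refl])
    fix i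
    have "sum (\<lambda>k. f (k div n) (k mod n)) {i * n..<i * n + n} =
        sum (\<lambda>k. f (k div n) (k mod n)) {0 + i * n..<n + i * n}"
      by (simp add: add.commute)
    also have "\<dots> = (\<Sum>j<n. f i j)"
      by (subst sum.shift_bounds_nat_ivl) (simp add: atLeast0LessThan)
    finally show "sum (\<lambda>k. f (k div n) (k mod n)) {i * n..<i * n + n} = (\<Sum>j<n. f i j)" .
  qed
  finally show ?thesis .
qed

lemma div_less_of_less_mult: "i < m * n \<Longrightarrow> i div n < (m::nat)"
  by (simp add: less_mult_imp_div_less)

lemma mod_less_of_less_mult: "i < m * n \<Longrightarrow> i mod n < (n::nat)"
  by (cases "n = 0") auto

lemma dim_kron [simp]:
  "dim_row (kron A B) = dim_row A * dim_row B" "dim_col (kron A B) = dim_col A * dim_col B"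
  by (simp_all add: kron_def)

lemma kron_carrier [intro]:
  "A \<in> carrier_mat m n \<Longrightarrow> B \<in> carrier_mat p q \<Longrightarrow> kron A B \<in> carrier_mat (m * p) (n * q)"
  by (intro carrier_matI) (simp_all add: carrier_matD)

lemma kron_index:
  "i < dim_row A * dim_row B \<Longrightarrow> j < dim_col A * dim_col B \<Longrightarrow>
    kron A B $$ (i, j) = A $$ (i div dim_row B, j div dim_col B) * B $$ (i mod dim_row B, j mod dim_col B)"
  by (simp add: kron_def)

lemma index_mult_mat_sum:
  "A \<in> carrier_mat m n \<Longrightarrow> B \<in> carrier_mat n p \<Longrightarrow> i < m \<Longrightarrow> j < p \<Longrightarrow>
    (A * B) $$ (i, j) = (\<Sum>k<n. A $$ (i, k) * B $$ (k, j))"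
  by (simp add: scalar_prod_def atLeast0LessThan carrier_matD)

lemma kron_mult_kron:
  fixes A B C D :: "'k::field Matrix.mat"
  assumes A: "A \<in> carrier_mat m n" and C: "C \<in> carrier_mat n p"
    and B: "B \<in> carrier_mat q r" and D: "D \<in> carrier_mat r t"
  shows "kron A B * kron C D = kron (A * C) (B * D)"
proof (rule eq_matI)
  note dims = carrier_matD[OF A] carrier_matD[OF B] carrier_matD[OF C] carrier_matD[OF D]
  fix i j
  assume "i < dim_row (kron (A * C) (B * D))" "j < dim_col (kron (A * C) (B * D))"
  then have i: "i < m * q" and j: "j < p * t" by (simp_all add: dims)
  note bounds = div_less_of_less_mult[OF i] mod_less_of_less_mult[OF i]
    div_less_of_less_mult[OF j] mod_less_of_less_mult[OF j]
  have "(kron A B * kron C D) $$ (i, j) = (\<Sum>k<n * r. kron A B $$ (i, k) * kron C D $$ (k, j))"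
    by (rule index_mult_mat_sum[OF kron_carrier[OF A B] kron_carrier[OF C D] i j])
  also have "\<dots> = (\<Sum>k<n * r. (A $$ (i div q, k div r) * C $$ (k div r, j div t)) *
      (B $$ (i mod q, k mod r) * D $$ (k mod r, j mod t)))"
    by (rule sum.cong[OF refl]) (use i j in \<open>simp add: dims kron_index ac_simps\<close>)
  also have "\<dots> = (\<Sum>k<n. \<Sum>l<r. (A $$ (i div q, k) * C $$ (k, j div t)) *
      (B $$ (i mod q, l) * D $$ (l, j mod t)))"
    by (rule sum_div_mod)
  also have "\<dots> = (A * C) $$ (i div q, j div t) * (B * D) $$ (i mod q, j mod t)"
    using bounds by (simp add: index_mult_mat_sum[OF A C] index_mult_mat_sum[OF B D] sum_product
        del: index_mult_mat)
  also have "\<dots> = kron (A * C) (B * D) $$ (i, j)"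
    by (subst kron_index) (simp_all only: dims i j index_mult_mat(2,3))
  finally show "(kron A B * kron C D) $$ (i, j) = kron (A * C) (B * D) $$ (i, j)" .
qed (simp_all add: carrier_matD[OF A] carrier_matD[OF B] carrier_matD[OF C] carrier_matD[OF D])

lemma kron_one: "kron (1\<^sub>m m) (1\<^sub>m n) = 1\<^sub>m (m * n)"
proof (rule eq_matI)
  fix i j assume "i < dim_row (1\<^sub>m (m * n))" "j < dim_col (1\<^sub>m (m * n))"
  then have i: "i < m * n" and j: "j < m * n" by auto
  have "i = j \<longleftrightarrow> i div n = j div n \<and> i mod n = j mod n" by (metis div_mult_mod_eq)
  then show "kron (1\<^sub>m m) (1\<^sub>m n) $$ (i, j) = 1\<^sub>m (m * n) $$ (i, j)"
    using i j by (simp add: kron_index div_less_of_less_mult[OF i] mod_less_of_less_mult[OF i]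
        div_less_of_less_mult[OF j] mod_less_of_less_mult[OF j])
qed auto

lemma kron_one_left [simp]: "kron (1\<^sub>m 1) A = A" "kron (1\<^sub>m (Suc 0)) A = A"
  by (rule eq_matI; simp add: kron_index)+

lemma kron_one_right [simp]: "kron A (1\<^sub>m 1) = A" "kron A (1\<^sub>m (Suc 0)) = A"
  by (rule eq_matI; simp add: kron_index)+

lemma kron_smult_left: "kron (c \<cdot>\<^sub>m A) B = c \<cdot>\<^sub>m kron A B"
proof (rule eq_matI)
  fix i j assume "i < dim_row (c \<cdot>\<^sub>m kron A B)" "j < dim_col (c \<cdot>\<^sub>m kron A B)"
  then have i: "i < dim_row A * dim_row B" and j: "j < dim_col A * dim_col B" by auto
  show "kron (c \<cdot>\<^sub>m A) B $$ (i, j) = (c \<cdot>\<^sub>m kron A B) $$ (i, j)"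
    using i j div_less_of_less_mult[OF i] div_less_of_less_mult[OF j]
    by (simp add: kron_index mult.assoc)
qed auto

lemma kron_smult_right: "kron A (c \<cdot>\<^sub>m B) = c \<cdot>\<^sub>m kron A B"
proof (rule eq_matI)
  fix i j assume "i < dim_row (c \<cdot>\<^sub>m kron A B)" "j < dim_col (c \<cdot>\<^sub>m kron A B)"
  then have i: "i < dim_row A * dim_row B" and j: "j < dim_col A * dim_col B" by auto
  show "kron A (c \<cdot>\<^sub>m B) $$ (i, j) = (c \<cdot>\<^sub>m kron A B) $$ (i, j)"
    using i j mod_less_of_less_mult[OF i] mod_less_of_less_mult[OF j]
    by (simp add: kron_index)
qed auto

lemma smult_smult_mat: "c \<cdot>\<^sub>m (d \<cdot>\<^sub>m A) = (c * d) \<cdot>\<^sub>m (A :: 'k::field Matrix.mat)"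
  by (rule eq_matI) (simp_all add: mult.assoc)

lemma one_smult_mat: "1 \<cdot>\<^sub>m A = (A :: 'k::field Matrix.mat)"
  by (rule eq_matI) simp_all

lemma zero_smult_mat: "f \<in> carrier_mat m n \<Longrightarrow> 0 \<cdot>\<^sub>m (f :: 'k::field Matrix.mat) = 0\<^sub>m m n"
  by (rule eq_matI) auto

lemma mat_1x1: "(A :: 'k::field Matrix.mat) \<in> carrier_mat 1 1 \<Longrightarrow> A = (A $$ (0, 0)) \<cdot>\<^sub>m 1\<^sub>m 1"
  by (rule eq_matI) auto

lemma kron_scalar_left:
  assumes "A \<in> carrier_mat 1 1"
  shows "kron A B = A $$ (0, 0) \<cdot>\<^sub>m B"
proof -
  have "kron A B = kron (A $$ (0, 0) \<cdot>\<^sub>m 1\<^sub>m 1) B" using mat_1x1[OF assms] by (rule arg_cong)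
  then show ?thesis by (simp only: kron_smult_left kron_one_left)
qed

lemma kron_scalar_right:
  assumes "A \<in> carrier_mat 1 1"
  shows "kron B A = A $$ (0, 0) \<cdot>\<^sub>m B"
proof -
  have "kron B A = kron B (A $$ (0, 0) \<cdot>\<^sub>m 1\<^sub>m 1)" using mat_1x1[OF assms] by (rule arg_cong)
  then show ?thesis by (simp only: kron_smult_right kron_one_right)
qed

text \<open>
  Compare the traces of \<open>A B\<close> and \<open>B A\<close>; the traces of identity matrices determine their sizes
  because the characteristic is zero.
\<close>

lemma mat_inverse_imp_square:
  fixes A B :: "'k::field_char_0 Matrix.mat"
  assumes A: "A \<in> carrier_mat m n" and B: "B \<in> carrier_mat n m"
    and AB: "A * B = 1\<^sub>m m" and BA: "B * A = 1\<^sub>m n"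
  shows "m = n"
proof -
  have "of_nat m = (\<Sum>i<m. (A * B) $$ (i, i))" by (simp add: AB)
  also have "\<dots> = (\<Sum>i<m. \<Sum>k<n. A $$ (i, k) * B $$ (k, i))"
    by (rule sum.cong[OF refl]) (simp add: index_mult_mat_sum[OF A B] del: index_mult_mat)
  also have "\<dots> = (\<Sum>k<n. \<Sum>i<m. B $$ (k, i) * A $$ (i, k))"
    by (subst sum.swap) (simp add: mult.commute)
  also have "\<dots> = (\<Sum>k<n. (B * A) $$ (k, k))"
    by (rule sum.cong[OF refl]) (simp add: index_mult_mat_sum[OF B A] del: index_mult_mat)
  also have "\<dots> = (of_nat n :: 'k)" by (simp add: BA)
  finally show ?thesis by simp
qed

lemma minus_mat_eq_0D:
  assumes A: "(A :: 'k::field Matrix.mat) \<in> carrier_mat m n" and B: "B \<in> carrier_mat m n" and eq: "A - B = 0\<^sub>m m n"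
  shows "A = B"
proof (rule eq_matI)
  fix i j assume ij: "i < dim_row B" "j < dim_col B"
  then have "(A - B) $$ (i, j) = 0" using B by (simp only: eq) auto
  then show "A $$ (i, j) = B $$ (i, j)" using ij by simp
qed (use A B in auto)

lemma minus_mat_self: "(A :: 'k::field Matrix.mat) \<in> carrier_mat m n \<Longrightarrow> A - A = 0\<^sub>m m n"
  by (rule eq_matI) auto

lemma smult_mat_cancel:
  assumes "a \<cdot>\<^sub>m f = b \<cdot>\<^sub>m (f :: 'k::field Matrix.mat)" "f \<in> carrier_mat m n" "f \<noteq> 0\<^sub>m m n"
  shows "a = b"
proof (rule ccontr)
  assume "a \<noteq> b"
  have "f = 0\<^sub>m m n"
  proof (rule eq_matI)
    fix i j assume "i < dim_row (0\<^sub>m m n :: 'k Matrix.mat)" "j < dim_col (0\<^sub>m m n :: 'k Matrix.mat)"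
    then have ij: "i < dim_row f" "j < dim_col f" "i < m" "j < n" using assms(2) by auto
    have "(a \<cdot>\<^sub>m f) $$ (i, j) = (b \<cdot>\<^sub>m f) $$ (i, j)" by (simp only: assms(1))
    then show "f $$ (i, j) = 0\<^sub>m m n $$ (i, j)" using ij \<open>a \<noteq> b\<close> by simp
  qed (use assms(2) in auto)
  with assms(3) show False by contradiction
qed

lemma pow_mat_commute:
  assumes A: "(A :: 'k::field Matrix.mat) \<in> carrier_mat n n"
  shows "A * A ^\<^sub>m k = A ^\<^sub>m k * A"
proof (induction k)
  case 0
  show ?case using A by simp
next
  case (Suc k)
  have "A * (A ^\<^sub>m k * A) = A * A ^\<^sub>m k * A"
    by (rule assoc_mult_mat[OF A pow_carrier_mat[OF A] A, symmetric])
  then show ?case by (simp add: Suc)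
qed

lemma scalar_mat_mult: "(a \<cdot>\<^sub>m 1\<^sub>m n) * (b \<cdot>\<^sub>m 1\<^sub>m n) = (a * b) \<cdot>\<^sub>m (1\<^sub>m n :: 'k::field Matrix.mat)"
  by (simp add: mult_smult_assoc_mat[OF one_carrier_mat smult_carrier_mat[OF one_carrier_mat]] smult_smult_mat)

lemma scalar_mat_power: "(a \<cdot>\<^sub>m 1\<^sub>m n) ^\<^sub>m k = (a ^ k) \<cdot>\<^sub>m (1\<^sub>m n :: 'k::field Matrix.mat)"
  by (induction k) (simp_all add: scalar_mat_mult one_smult_mat mult.commute)

lemma scalar_mat_1_eq_iff: "a \<cdot>\<^sub>m 1\<^sub>m 1 = b \<cdot>\<^sub>m (1\<^sub>m 1 :: 'k::field Matrix.mat) \<longleftrightarrow> a = b"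
proof
  assume "a \<cdot>\<^sub>m 1\<^sub>m 1 = b \<cdot>\<^sub>m (1\<^sub>m 1 :: 'k Matrix.mat)"
  then have "(a \<cdot>\<^sub>m 1\<^sub>m 1) $$ (0, 0) = (b \<cdot>\<^sub>m (1\<^sub>m 1 :: 'k Matrix.mat)) $$ (0, 0)" by simp
  then show "a = b" by simp
qed simp

definition mat2 :: "'k \<Rightarrow> 'k \<Rightarrow> 'k \<Rightarrow> 'k \<Rightarrow> 'k Matrix.mat" where
  "mat2 a b c d = Matrix.mat 2 2
     (\<lambda>(i, j). if i = 0 then if j = 0 then a else b else if j = 0 then c else d)"

lemma mat2_carrier [simp]: "mat2 a b c d \<in> carrier_mat 2 2"
  by (simp add: mat2_def)

lemma dim_mat2 [simp]: "dim_row (mat2 a b c d) = 2" "dim_col (mat2 a b c d) = 2"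
  by (simp_all add: mat2_def)

lemma mat2_index [simp]: "mat2 a b c d $$ (0, 0) = a" "mat2 a b c d $$ (0, Suc 0) = b"
  "mat2 a b c d $$ (Suc 0, 0) = c" "mat2 a b c d $$ (Suc 0, Suc 0) = d"
  by (simp_all add: mat2_def)

lemma eq_mat2I:
  "A \<in> carrier_mat 2 2 \<Longrightarrow> A = mat2 (A $$ (0, 0)) (A $$ (0, 1)) (A $$ (1, 0)) (A $$ (1, 1))"
  by (rule eq_matI) (auto simp: numeral_2_eq_2 less_Suc_eq)

lemma mat2_eq_iff: "mat2 a b c d = mat2 a' b' c' d' \<longleftrightarrow> a = a' \<and> b = b' \<and> c = c' \<and> d = d'"
  by (metis mat2_index)

lemma mat2_mult: "mat2 a b c d * mat2 a' b' c' d' =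
    mat2 (a * a' + b * c') (a * b' + b * d') (c * a' + d * c') (c * b' + d * (d' :: 'k::field))"
  by (rule eq_matI) (auto simp: index_mult_mat_sum[OF mat2_carrier mat2_carrier] lessThan_Suc less_Suc_eq numeral_2_eq_2
      simp del: index_mult_mat(1))

lemma mat2_smult: "k \<cdot>\<^sub>m mat2 a b c d = mat2 (k * a) (k * b) (k * c) (k * (d :: 'k::field))"
  by (rule eq_matI) (auto simp: numeral_2_eq_2 less_Suc_eq)

lemma mat2_add: "mat2 a b c d + mat2 a' b' c' d' = mat2 (a + a') (b + b') (c + c') (d + (d' :: 'k::field))"
  by (rule eq_matI) (auto simp: numeral_2_eq_2 less_Suc_eq)

lemma mat2_one: "1\<^sub>m 2 = mat2 1 0 0 (1 :: 'k::field)"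
  by (rule eq_matI) (auto simp: numeral_2_eq_2 less_Suc_eq)

lemma mat2_zero: "0\<^sub>m 2 2 = mat2 0 0 0 (0 :: 'k::field)"
  by (rule eq_matI) (auto simp: numeral_2_eq_2 less_Suc_eq)

lemma mat2_diag_power: "mat2 a 0 0 d ^\<^sub>m k = mat2 (a ^ k) 0 0 ((d :: 'k::field) ^ k)"
  by (induction k) (simp_all add: mat2_mult mat2_one mult.commute)

definition col2 :: "'k \<Rightarrow> 'k \<Rightarrow> 'k Matrix.mat" where
  "col2 a b = Matrix.mat 2 1 (\<lambda>(i, j). if i = 0 then a else b)"

definition row2 :: "'k \<Rightarrow> 'k \<Rightarrow> 'k Matrix.mat" where
  "row2 a b = Matrix.mat 1 2 (\<lambda>(i, j). if j = 0 then a else b)"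

lemma col2_carrier [simp]: "col2 a b \<in> carrier_mat 2 1" "col2 a b \<in> carrier_mat 2 (Suc 0)"
  and row2_carrier [simp]: "row2 a b \<in> carrier_mat 1 2" "row2 a b \<in> carrier_mat (Suc 0) 2"
  by (simp_all add: col2_def row2_def)

lemma dim_col2_row2 [simp]:
  "dim_row (col2 a b) = 2" "dim_col (col2 a b) = 1" "dim_row (row2 a b) = 1" "dim_col (row2 a b) = 2"
  by (simp_all add: col2_def row2_def)

lemma col2_row2_index [simp]: "col2 a b $$ (0, 0) = a" "col2 a b $$ (Suc 0, 0) = b"
  "row2 a b $$ (0, 0) = a" "row2 a b $$ (0, Suc 0) = b"
  by (simp_all add: col2_def row2_def)

lemma mat2_col2: "mat2 a b c d * col2 u w = col2 (a * u + b * w) (c * u + d * (w :: 'k::field))"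
  by (rule eq_matI) (auto simp: index_mult_mat_sum[OF mat2_carrier col2_carrier(1)] lessThan_Suc less_Suc_eq
      numeral_2_eq_2 simp del: index_mult_mat(1))

lemma row2_mat2: "row2 u w * mat2 a b c d = row2 (u * a + w * c) (u * b + w * (d :: 'k::field))"
  by (rule eq_matI) (auto simp: index_mult_mat_sum[OF row2_carrier(1) mat2_carrier] lessThan_Suc less_Suc_eq
      numeral_2_eq_2 simp del: index_mult_mat(1))

lemma col2_row2_smult: "k \<cdot>\<^sub>m col2 a b = col2 (k * a) (k * (b :: 'k::field))"
  "k \<cdot>\<^sub>m row2 a b = row2 (k * a) (k * (b :: 'k::field))"
  by (rule eq_matI; auto simp: less_Suc_eq numeral_2_eq_2)+

lemma col2_row2_zero: "0\<^sub>m 2 1 = col2 0 (0 :: 'k::field)" "0\<^sub>m 1 2 = row2 0 (0 :: 'k::field)"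
  by (rule eq_matI; auto simp: less_Suc_eq numeral_2_eq_2)+

lemma col2_row2_eq_iff: "col2 a b = col2 a' b' \<longleftrightarrow> a = a' \<and> b = b'" "row2 a b = row2 a' b' \<longleftrightarrow> a = a' \<and> b = b'"
  by (metis col2_row2_index)+

section \<open>Modules and their tensor products\<close>

lemma functional_sum:
  fixes \<phi> :: "'k::field^'b \<Rightarrow> 'k"
  assumes add: "\<And>a b. \<phi> (a + b) = \<phi> a + \<phi> b" and smult: "\<And>c a. \<phi> (c *s a) = c * \<phi> a"
  shows "\<phi> (\<Sum>p\<in>S. c p *s u p) = (\<Sum>p\<in>S. c p * \<phi> (u p))"
proof -
  have "\<phi> 0 = 0" using smult[of 0 0] by simp
  then show ?thesis by (induction S rule: infinite_finite_induct) (simp_all add: add smult)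
qed

lemma functional_expansion:
  fixes \<phi> :: "'k::field^'b::finite \<Rightarrow> 'k"
  assumes "\<And>a b. \<phi> (a + b) = \<phi> a + \<phi> b" "\<And>c a. \<phi> (c *s a) = c * \<phi> a"
  shows "\<phi> a = (\<Sum>b\<in>UNIV. a $ b * \<phi> (axis b 1))"
  using functional_sum[OF assms, where S = UNIV and c = "\<lambda>b. a $ b" and u = "\<lambda>b. axis b 1"] by (simp add: basis_expansion)

context
  fixes H :: "('k::field, 'b::finite) hopf" and V :: "('k, 'b) lmod"
  assumes V: "is_left_module H V"
begin

lemma module_carrier: "snd V a \<in> carrier_mat (fst V) (fst V)"
  and module_add: "snd V (a + b) = snd V a + snd V b"
  and module_smult: "snd V (c *s a) = c \<cdot>\<^sub>m snd V a"
  and module_mult: "snd V (hmult H a b) = snd V a * snd V b"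
  and module_unit: "snd V (hunit H) = 1\<^sub>m (fst V)"
  using V by (auto simp: is_left_module_def split: prod.splits)

lemma module_zero: "snd V 0 = 0\<^sub>m (fst V) (fst V)"
proof -
  have "snd V 0 = 0 \<cdot>\<^sub>m snd V 0" using module_smult[of 0 0] by simp
  also have "\<dots> = 0\<^sub>m (fst V) (fst V)"
    by (rule eq_matI) (simp_all add: carrier_matD[OF module_carrier])
  finally show ?thesis .
qed

lemma module_expansion:
  assumes "i < fst V" "j < fst V"
  shows "snd V a $$ (i, j) = (\<Sum>b\<in>UNIV. a $ b * snd V (axis b 1) $$ (i, j))"
  by (rule functional_expansion)
    (use assms carrier_matD[OF module_carrier] in \<open>simp_all add: module_add module_smult\<close>)

end

lemma is_left_moduleI:
  assumes "\<And>a. snd V a \<in> carrier_mat (fst V) (fst V)" "\<And>a b. snd V (a + b) = snd V a + snd V b"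
    "\<And>c a. snd V (c *s a) = c \<cdot>\<^sub>m snd V a" "\<And>a b. snd V (hmult H a b) = snd V a * snd V b"
    "snd V (hunit H) = 1\<^sub>m (fst V)"
  shows "is_left_module H V"
  using assms by (simp add: is_left_module_def case_prod_beta)

text \<open>
  The action of an element of \<open>H \<otimes> H\<close> on \<open>V \<otimes> W\<close>, that is \<open>\<rho> \<otimes> \<sigma>\<close>; the tensor product module
  is its composite with the comultiplication.
\<close>

definition tensor_action ::
    "('k::field, 'b::finite) lmod \<Rightarrow> ('k, 'b) lmod \<Rightarrow> 'k^('b \<times> 'b) \<Rightarrow> 'k Matrix.mat" where
  "tensor_action V W t = Matrix.mat (fst V * fst W) (fst V * fst W)
     (\<lambda>ij. \<Sum>p\<in>UNIV. t $ p * kron (snd V (axis (fst p) 1)) (snd W (axis (snd p) 1)) $$ ij)"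

lemma fst_tensor_module [simp]: "fst (tensor_module H V W) = fst V * fst W"
  by (simp add: tensor_module_def)

lemma snd_tensor_module: "snd (tensor_module H V W) a = tensor_action V W (comult H a)"
  by (simp add: tensor_module_def tensor_action_def)

lemma tensor_action_carrier: "tensor_action V W t \<in> carrier_mat (fst V * fst W) (fst V * fst W)"
  by (simp add: tensor_action_def)

lemma dim_tensor_action [simp]:
  "dim_row (tensor_action V W t) = fst V * fst W" "dim_col (tensor_action V W t) = fst V * fst W"
  by (simp_all add: tensor_action_def)

lemma tensor_action_add: "tensor_action V W (s + t) = tensor_action V W s + tensor_action V W t"
  by (rule eq_matI) (simp_all add: tensor_action_def algebra_simps sum.distrib)

lemma tensor_action_smult: "tensor_action V W (c *s t) = c \<cdot>\<^sub>m tensor_action V W t"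
  by (rule eq_matI) (simp_all add: tensor_action_def algebra_simps sum_distrib_left)

lemma tensor_action_tens:
  assumes V: "is_left_module H V" and W: "is_left_module H W"
  shows "tensor_action V W (a \<otimes>\<^sub>v b) = kron (snd V a) (snd W b)"
proof (rule eq_matI)
  note dims = carrier_matD[OF module_carrier[OF V]] carrier_matD[OF module_carrier[OF W]]
  fix i j
  assume "i < dim_row (kron (snd V a) (snd W b))" "j < dim_col (kron (snd V a) (snd W b))"
  then have i: "i < fst V * fst W" and j: "j < fst V * fst W" by (simp_all add: dims)
  note bounds = div_less_of_less_mult[OF i] mod_less_of_less_mult[OF i]
    div_less_of_less_mult[OF j] mod_less_of_less_mult[OF j]
  have "tensor_action V W (a \<otimes>\<^sub>v b) $$ (i, j) = (\<Sum>p\<in>UNIV \<times> UNIV. (a $ fst p * b $ snd p) *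
      (snd V (axis (fst p) 1) $$ (i div fst W, j div fst W) *
       snd W (axis (snd p) 1) $$ (i mod fst W, j mod fst W)))"
    using i j by (simp add: tensor_action_def kron_index dims tens_def)
  also have "\<dots> = (\<Sum>p\<in>UNIV. a $ p * snd V (axis p 1) $$ (i div fst W, j div fst W)) *
      (\<Sum>p\<in>UNIV. b $ p * snd W (axis p 1) $$ (i mod fst W, j mod fst W))"
    unfolding sum_product sum.cartesian_product
    by (rule sum.cong) (auto simp: ac_simps)
  also have "\<dots> = kron (snd V a) (snd W b) $$ (i, j)"
    using i j bounds by (simp add: kron_index dims module_expansion[OF V, symmetric]
        module_expansion[OF W, symmetric])
  finally show "tensor_action V W (a \<otimes>\<^sub>v b) $$ (i, j) = kron (snd V a) (snd W b) $$ (i, j)" .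
qed (simp_all add: carrier_matD[OF module_carrier[OF V]] carrier_matD[OF module_carrier[OF W]])

lemma tensor_action_sum:
  assumes "i < fst V * fst W" "j < fst V * fst W"
  shows "tensor_action V W (\<Sum>p\<in>S. c p *s u p) $$ (i, j) = (\<Sum>p\<in>S. c p * tensor_action V W (u p) $$ (i, j))"
  by (rule functional_sum) (use assms in \<open>simp_all add: tensor_action_add tensor_action_smult\<close>)

lemma tensor_action_tmult:
  assumes V: "is_left_module H V" and W: "is_left_module H W"
  shows "tensor_action V W (tmult H s t) = tensor_action V W s * tensor_action V W t"
proof (rule eq_matI)
  define E where "E p = kron (snd V (axis (fst p) 1)) (snd W (axis (snd p) 1))" for p :: "'b \<times> 'b"
  let ?n = "fst V * fst W"
  have E: "E p \<in> carrier_mat ?n ?n" for p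
    unfolding E_def by (intro kron_carrier module_carrier[OF V] module_carrier[OF W])
  have EE: "tensor_action V W (hmult H (axis (fst p) 1) (axis (fst q) 1) \<otimes>\<^sub>v
      hmult H (axis (snd p) 1) (axis (snd q) 1)) = E p * E q" for p q
    unfolding tensor_action_tens[OF V W] module_mult[OF V] module_mult[OF W] E_def
    by (rule kron_mult_kron[symmetric]) (rule module_carrier[OF V] module_carrier[OF W])+
  have index: "tensor_action V W r $$ (i, j) = (\<Sum>p\<in>UNIV. r $ p * E p $$ (i, j))"
    if "i < ?n" "j < ?n" for r i j
    using that by (simp add: tensor_action_def E_def)
  fix i j
  assume "i < dim_row (tensor_action V W s * tensor_action V W t)"
    "j < dim_col (tensor_action V W s * tensor_action V W t)"
  then have i: "i < ?n" and j: "j < ?n" by simp_all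
  have "tensor_action V W (tmult H s t) $$ (i, j) =
      (\<Sum>p\<in>UNIV. s $ p * (\<Sum>q\<in>UNIV. t $ q * (\<Sum>k<?n. E p $$ (i, k) * E q $$ (k, j))))"
    by (simp only: tmult_def tlift_def tensor_action_sum[OF i j] EE index_mult_mat_sum[OF E E i j])
  also have "\<dots> = (\<Sum>p\<in>UNIV. \<Sum>q\<in>UNIV. \<Sum>k<?n. (s $ p * E p $$ (i, k)) * (t $ q * E q $$ (k, j)))"
    by (simp add: sum_distrib_left algebra_simps)
  also have "\<dots> = (\<Sum>p\<in>UNIV. \<Sum>k<?n. \<Sum>q\<in>UNIV. (s $ p * E p $$ (i, k)) * (t $ q * E q $$ (k, j)))"
    by (rule sum.cong[OF refl]) (rule sum.swap)
  also have "\<dots> = (\<Sum>k<?n. \<Sum>p\<in>UNIV. \<Sum>q\<in>UNIV. (s $ p * E p $$ (i, k)) * (t $ q * E q $$ (k, j)))"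
    by (rule sum.swap)
  also have "\<dots> = (\<Sum>k<?n. tensor_action V W s $$ (i, k) * tensor_action V W t $$ (k, j))"
    by (rule sum.cong[OF refl]) (simp add: index i j sum_product)
  also have "\<dots> = (tensor_action V W s * tensor_action V W t) $$ (i, j)"
    by (rule index_mult_mat_sum[symmetric, OF tensor_action_carrier tensor_action_carrier i j])
  finally show "tensor_action V W (tmult H s t) $$ (i, j) =
      (tensor_action V W s * tensor_action V W t) $$ (i, j)" .
qed simp_all

lemma linear_addD: "Vector_Spaces.linear s1 s2 f \<Longrightarrow> f (a + b) = f a + f b"
  and linear_scaleD: "Vector_Spaces.linear s1 s2 f \<Longrightarrow> f (s1 c a) = s2 c (f a)"
  by (simp_all add: Vector_Spaces.linear_iff)

text \<open>
  The action of \<open>H \<otimes> H\<close> on \<open>V \<otimes> W\<close> is multiplicative and the comultiplication is an algebra map.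
\<close>

lemma is_left_module_tensor:
  assumes H: "is_hopf_algebra H" and V: "is_left_module H V" and W: "is_left_module H W"
  shows "is_left_module H (tensor_module H V W)"
proof -
  have lin: "Vector_Spaces.linear (*s) (*s) (comult H)"
    using H by (simp add: is_hopf_algebra_def is_coalgebra_def)
  have "comult H (hunit H) = hunit H \<otimes>\<^sub>v hunit H"
    "\<And>a b. comult H (hmult H a b) = tmult H (comult H a) (comult H b)"
    using H by (simp_all add: is_hopf_algebra_def)
  then have
    "snd (tensor_module H V W) (hunit H) = 1\<^sub>m (fst V * fst W)"
    "snd (tensor_module H V W) (hmult H a b) =
      snd (tensor_module H V W) a * snd (tensor_module H V W) b" for a b
    by (simp_all add: snd_tensor_module tensor_action_tmult[OF V W] tensor_action_tens[OF V W]
        module_unit[OF V] module_unit[OF W] kron_one)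
  moreover have "snd (tensor_module H V W) (a + b) = snd (tensor_module H V W) a + snd (tensor_module H V W) b"
    "snd (tensor_module H V W) (c *s a) = c \<cdot>\<^sub>m snd (tensor_module H V W) a" for a b c
    by (simp_all add: snd_tensor_module linear_addD[OF lin] linear_scaleD[OF lin]
        tensor_action_add tensor_action_smult)
  ultimately show ?thesis
    by (intro is_left_moduleI) (simp_all add: snd_tensor_module[of H V W for V W] tensor_action_carrier)
qed

lemma fst_trivial_module [simp]: "fst (trivial_module H) = 1"
  by (simp add: trivial_module_def)

lemma snd_trivial_module: "snd (trivial_module H) a = counit H a \<cdot>\<^sub>m 1\<^sub>m 1"
  by (simp add: trivial_module_def)

lemma is_left_module_trivial:
  assumes "is_hopf_algebra H"
  shows "is_left_module H (trivial_module H)"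
proof -
  have lin: "Vector_Spaces.linear (*s) (*) (counit H)"
    and "\<And>a b. counit H (hmult H a b) = counit H a * counit H b" "counit H (hunit H) = 1"
    using assms by (auto simp: is_hopf_algebra_def is_coalgebra_def)
  then show ?thesis
    unfolding is_left_module_def trivial_module_def
    by (auto simp: linear_addD[OF lin] linear_scaleD[OF lin] intro!: eq_matI)
qed

lemma module_homD:
  "f \<in> module_hom V W \<Longrightarrow> f \<in> carrier_mat (fst W) (fst V)"
  "f \<in> module_hom V W \<Longrightarrow> f * snd V a = snd W a * f"
  by (simp_all add: module_hom_def)

lemma module_hom_comp:
  assumes V: "is_left_module H V" and W: "is_left_module H W" and U: "is_left_module H U"
    and f: "f \<in> module_hom V W" and g: "g \<in> module_hom W U"
  shows "g * f \<in> module_hom V U"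
proof -
  note c = module_homD(1)[OF f] module_homD(1)[OF g] module_carrier[OF V] module_carrier[OF W]
    module_carrier[OF U]
  have "g * f * snd V a = snd U a * (g * f)" for a
  proof -
    have "g * f * snd V a = g * (f * snd V a)" by (rule assoc_mult_mat[OF c(2,1,3)])
    also have "\<dots> = g * snd W a * f"
      by (subst module_homD(2)[OF f]) (rule assoc_mult_mat[OF c(2,4,1), symmetric])
    also have "\<dots> = snd U a * (g * f)"
      by (subst module_homD(2)[OF g]) (rule assoc_mult_mat[OF c(5,2,1)])
    finally show ?thesis .
  qed
  then show ?thesis using mult_carrier_mat[OF c(2,1)] by (simp add: module_hom_def)
qed

lemma module_hom_one: "is_left_module H V \<Longrightarrow> 1\<^sub>m (fst V) \<in> module_hom V V"
  by (simp add: module_hom_def left_mult_one_mat[OF module_carrier] right_mult_one_mat[OF module_carrier])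

lemma module_hom_zero:
  assumes "is_left_module H V" "is_left_module H W"
  shows "0\<^sub>m (fst W) (fst V) \<in> module_hom V W"
  using left_mult_zero_mat[OF module_carrier[OF assms(1)]] right_mult_zero_mat[OF module_carrier[OF assms(2)]]
  by (simp add: module_hom_def)

text \<open>
  The basis vectors of the tensor product are pure tensors.
\<close>

lemma tens_induct:
  fixes t :: "'k::field^('b::finite \<times> 'c::finite)"
  assumes tens: "\<And>a b. P (a \<otimes>\<^sub>v b)" and add: "\<And>s t. P s \<Longrightarrow> P t \<Longrightarrow> P (s + t)"
    and smult: "\<And>c t. P t \<Longrightarrow> P (c *s t)"
  shows "P t"
proof -
  have axis: "axis p (1 :: 'k) = axis (fst p) 1 \<otimes>\<^sub>v axis (snd p) 1" for p :: "'b \<times> 'c"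
    by (rule Finite_Cartesian_Product.vec_eq_iff[THEN iffD2]) (auto simp: tens_def axis_def prod_eq_iff)
  have zero: "P 0" using smult[OF tens, of 0] by simp
  have "P (\<Sum>p\<in>S. t $ p *s axis p 1)" for S :: "('b \<times> 'c) set"
    by (induction S rule: infinite_finite_induct) (auto simp: zero intro!: add smult simp: axis tens)
  from this[of UNIV] show ?thesis by (simp add: basis_expansion)
qed

lemma kron_module_hom:
  assumes V: "is_left_module H V" and W: "is_left_module H W"
    and V': "is_left_module H V'" and W': "is_left_module H W'"
    and f: "f \<in> module_hom V V'" and g: "g \<in> module_hom W W'"
  shows "kron f g \<in> module_hom (tensor_module H V W) (tensor_module H V' W')"
proof -
  note f1 = module_homD(1)[OF f] and g1 = module_homD(1)[OF g]
  note c = module_carrier[OF V] module_carrier[OF W] module_carrier[OF V'] module_carrier[OF W']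
  note k = kron_carrier[OF f1 g1]
  have "kron f g * tensor_action V W t = tensor_action V' W' t * kron f g" for t
  proof (induction t rule: tens_induct)
    case (1 a b)
    show ?case
      by (simp add: tensor_action_tens[OF V W] tensor_action_tens[OF V' W'] kron_mult_kron[OF f1 c(1) g1 c(2)]
          kron_mult_kron[OF c(3) f1 c(4) g1] module_homD(2)[OF f] module_homD(2)[OF g])
  qed (simp_all add: tensor_action_add tensor_action_smult
      mult_add_distrib_mat[OF k tensor_action_carrier tensor_action_carrier]
      add_mult_distrib_mat[OF tensor_action_carrier tensor_action_carrier k]
      mult_smult_distrib[OF k tensor_action_carrier] mult_smult_assoc_mat[OF tensor_action_carrier k])
  then show ?thesis using k by (simp add: module_hom_def snd_tensor_module)
qed

section \<open>Equivalences of categories\<close>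

text \<open>
  The laws of composition, on which transporting morphisms along an equivalence relies; a record of
  data alone does not guarantee them.
\<close>

definition is_category :: "('o, 'm, 'k) lin_moncat \<Rightarrow> bool" where
  "is_category C \<longleftrightarrow>
     (\<forall>X\<in>Obj C. Id C X \<in> Hom C X X) \<and>
     (\<forall>X\<in>Obj C. \<forall>Y\<in>Obj C. \<forall>Z\<in>Obj C. \<forall>f\<in>Hom C X Y. \<forall>g\<in>Hom C Y Z. Comp C g f \<in> Hom C X Z) \<and>
     (\<forall>X\<in>Obj C. \<forall>Y\<in>Obj C. \<forall>f\<in>Hom C X Y. Comp C f (Id C X) = f \<and> Comp C (Id C Y) f = f) \<and>
     (\<forall>W\<in>Obj C. \<forall>X\<in>Obj C. \<forall>Y\<in>Obj C. \<forall>Z\<in>Obj C. \<forall>f\<in>Hom C W X. \<forall>g\<in>Hom C X Y. \<forall>h\<in>Hom C Y Z.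
        Comp C (Comp C h g) f = Comp C h (Comp C g f))"

context
  fixes C :: "('o, 'm, 'k) lin_moncat"
  assumes C: "is_category C"
begin

lemma cat_id: "X \<in> Obj C \<Longrightarrow> Id C X \<in> Hom C X X"
  and cat_comp: "X \<in> Obj C \<Longrightarrow> Y \<in> Obj C \<Longrightarrow> Z \<in> Obj C \<Longrightarrow> f \<in> Hom C X Y \<Longrightarrow> g \<in> Hom C Y Z \<Longrightarrow>
    Comp C g f \<in> Hom C X Z"
  and cat_right_id: "X \<in> Obj C \<Longrightarrow> Y \<in> Obj C \<Longrightarrow> f \<in> Hom C X Y \<Longrightarrow> Comp C f (Id C X) = f"
  and cat_left_id: "X \<in> Obj C \<Longrightarrow> Y \<in> Obj C \<Longrightarrow> f \<in> Hom C X Y \<Longrightarrow> Comp C (Id C Y) f = f"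
  and cat_assoc: "W \<in> Obj C \<Longrightarrow> X \<in> Obj C \<Longrightarrow> Y \<in> Obj C \<Longrightarrow> Z \<in> Obj C \<Longrightarrow>
    f \<in> Hom C W X \<Longrightarrow> g \<in> Hom C X Y \<Longrightarrow> h \<in> Hom C Y Z \<Longrightarrow>
    Comp C (Comp C h g) f = Comp C h (Comp C g f)"
  using C unfolding is_category_def by blast+

lemma iso_right_cancel:
  assumes "X \<in> Obj C" "Y \<in> Obj C" "Z \<in> Obj C" and e: "is_iso C X Y e"
    and f: "f \<in> Hom C Y Z" and g: "g \<in> Hom C Y Z" and eq: "Comp C f e = Comp C g e"
  shows "f = g"
proof -
  from e obtain e' where e': "e \<in> Hom C X Y" "e' \<in> Hom C Y X" "Comp C e e' = Id C Y"
    by (auto simp: is_iso_def)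
  have "Comp C (Comp C h e) e' = h" if "h \<in> Hom C Y Z" for h
    by (simp only: cat_assoc[OF assms(2,1,2,3) e'(2,1) that] e'(3) cat_right_id[OF assms(2,3) that])
  from this[OF f] this[OF g] show ?thesis unfolding eq by (rule trans[OF sym])
qed

lemma iso_left_cancel:
  assumes "X \<in> Obj C" "Y \<in> Obj C" "Z \<in> Obj C" and e: "is_iso C X Y e"
    and f: "f \<in> Hom C Z X" and g: "g \<in> Hom C Z X" and eq: "Comp C e f = Comp C e g"
  shows "f = g"
proof -
  from e obtain e' where e': "e \<in> Hom C X Y" "e' \<in> Hom C Y X" "Comp C e' e = Id C X"
    by (auto simp: is_iso_def)
  have "Comp C e' (Comp C e h) = h" if "h \<in> Hom C Z X" for h
    by (simp only: cat_assoc[OF assms(3,1,2,1) that e'(1,2), symmetric] e'(3) cat_left_id[OF assms(3,1) that])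
  from this[OF f] this[OF g] show ?thesis unfolding eq by (rule trans[OF sym])
qed

lemma left_inverse_comp:
  assumes X: "X \<in> Obj C" and Y: "Y \<in> Obj C" and Z: "Z \<in> Obj C"
    and e: "e \<in> Hom C X Y" and e': "e' \<in> Hom C Y X" and e'e: "Comp C e' e = Id C X"
    and f: "f \<in> Hom C Y Z" and f': "f' \<in> Hom C Z Y" and f'f: "Comp C f' f = Id C Y"
  shows "Comp C (Comp C e' f') (Comp C f e) = Id C X"
proof -
  have "Comp C (Comp C e' f') (Comp C f e) = Comp C e' (Comp C f' (Comp C f e))"
    by (rule cat_assoc[OF X Z Y X cat_comp[OF X Y Z e f] f' e'])
  also have "Comp C f' (Comp C f e) = Comp C (Comp C f' f) e"
    by (rule cat_assoc[OF X Y Z Y e f f', symmetric])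
  also have "\<dots> = e" by (simp add: f'f cat_left_id[OF X Y e])
  finally show ?thesis by (simp add: e'e)
qed

lemma is_iso_comp:
  assumes X: "X \<in> Obj C" and Y: "Y \<in> Obj C" and Z: "Z \<in> Obj C"
    and e: "is_iso C X Y e" and f: "is_iso C Y Z f"
  shows "is_iso C X Z (Comp C f e)"
proof -
  from e obtain e' where e': "e \<in> Hom C X Y" "e' \<in> Hom C Y X" "Comp C e' e = Id C X" "Comp C e e' = Id C Y"
    by (auto simp: is_iso_def)
  from f obtain f' where f': "f \<in> Hom C Y Z" "f' \<in> Hom C Z Y" "Comp C f' f = Id C Y" "Comp C f f' = Id C Z"
    by (auto simp: is_iso_def)
  have "Comp C (Comp C e' f') (Comp C f e) = Id C X" "Comp C (Comp C f e) (Comp C e' f') = Id C Z"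
    using left_inverse_comp[OF X Y Z e'(1,2,3) f'(1,2,3)] left_inverse_comp[OF Z Y X f'(2,1,4) e'(2,1,4)]
    by simp_all
  then show ?thesis
    unfolding is_iso_def
    using cat_comp[OF X Y Z e'(1) f'(1)] cat_comp[OF Z Y X f'(2) e'(2)] by blast
qed

lemma is_iso_id: "X \<in> Obj C \<Longrightarrow> is_iso C X X (Id C X)"
  unfolding is_iso_def using cat_id cat_left_id by blast

end

lemma is_iso_sym: "is_iso C X Y f \<Longrightarrow> \<exists>f'. is_iso C Y X f'"
  unfolding is_iso_def by blast

lemma functor_obj: "is_fctr C D F \<Longrightarrow> X \<in> Obj C \<Longrightarrow> fobj F X \<in> Obj D"
  and functor_hom: "is_fctr C D F \<Longrightarrow> X \<in> Obj C \<Longrightarrow> Y \<in> Obj C \<Longrightarrow> f \<in> Hom C X Y \<Longrightarrow>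
    fmor F X Y f \<in> Hom D (fobj F X) (fobj F Y)"
  and functor_id: "is_fctr C D F \<Longrightarrow> X \<in> Obj C \<Longrightarrow> fmor F X X (Id C X) = Id D (fobj F X)"
  and functor_comp: "is_fctr C D F \<Longrightarrow> X \<in> Obj C \<Longrightarrow> Y \<in> Obj C \<Longrightarrow> Z \<in> Obj C \<Longrightarrow>
    f \<in> Hom C X Y \<Longrightarrow> g \<in> Hom C Y Z \<Longrightarrow>
    fmor F X Z (Comp C g f) = Comp D (fmor F Y Z g) (fmor F X Y f)"
  unfolding is_fctr_def by blast+

lemma functor_iso:
  assumes F: "is_fctr C D F" and X: "X \<in> Obj C" and Y: "Y \<in> Obj C" and f: "is_iso C X Y f"
  shows "is_iso D (fobj F X) (fobj F Y) (fmor F X Y f)"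
proof -
  from f obtain g where g: "f \<in> Hom C X Y" "g \<in> Hom C Y X" "Comp C g f = Id C X" "Comp C f g = Id C Y"
    by (auto simp: is_iso_def)
  then show ?thesis
    unfolding is_iso_def
    using functor_comp[OF F X Y X, of f g] functor_comp[OF F Y X Y, of g f]
    by (intro conjI bexI[of _ "fmor F Y X g"])
      (simp_all add: functor_hom[OF F] functor_id[OF F] X Y)
qed

text \<open>
  Naturality of \<open>\<eta>\<close> recovers \<open>f\<close> from \<open>G (F f)\<close>. Only this one composite enters, so that the lemma
  applies to both functors of an equivalence.
\<close>

lemma faithful_of_retraction:
  assumes C: "is_category C" and F: "is_fctr C D F" and G: "is_fctr D C G"
    and \<eta>: "is_nat_iso C C (comp_fctr G F) id_fctr \<eta>"
    and X: "X \<in> Obj C" and Y: "Y \<in> Obj C" and f: "f \<in> Hom C X Y" and g: "g \<in> Hom C X Y"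
    and eq: "fmor F X Y f = fmor F X Y g"
  shows "f = g"
proof (rule iso_right_cancel[OF C _ X Y _ f g])
  show "fobj G (fobj F X) \<in> Obj C" by (intro functor_obj[OF G] functor_obj[OF F] X)
  show "is_iso C (fobj G (fobj F X)) X (\<eta> X)"
    using \<eta> X by (simp add: is_nat_iso_def comp_fctr_def id_fctr_def)
  have "Comp C (\<eta> Y) (fmor G (fobj F X) (fobj F Y) (fmor F X Y h)) = Comp C h (\<eta> X)"
    if "h \<in> Hom C X Y" for h
    using \<eta> X Y that by (simp add: is_nat_iso_def comp_fctr_def id_fctr_def)
  from this[OF f] this[OF g] show "Comp C f (\<eta> X) = Comp C g (\<eta> X)" by (simp add: eq)
qed

lemma equivalence_faithful:
  assumes "is_category C" "is_equivalence C D F" "X \<in> Obj C" "Y \<in> Obj C"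
    "f \<in> Hom C X Y" "g \<in> Hom C X Y" "fmor F X Y f = fmor F X Y g"
  shows "f = g"
  using assms faithful_of_retraction unfolding is_equivalence_def by metis

text \<open>
  The preimage of \<open>h\<close> is \<open>\<eta>\<^sub>Y \<circ> G h \<circ> \<eta>\<^sub>X\<^sup>-\<^sup>1\<close>. It has the same image under \<open>G F\<close> as it should, and
  \<open>G\<close> is faithful.
\<close>

lemma equivalence_full:
  assumes C: "is_category C" and D: "is_category D" and E: "is_equivalence C D F"
    and X: "X \<in> Obj C" and Y: "Y \<in> Obj C" and h: "h \<in> Hom D (fobj F X) (fobj F Y)"
  shows "\<exists>f\<in>Hom C X Y. fmor F X Y f = h"
proof -
  from E obtain G \<eta> \<theta> where F: "is_fctr C D F" and G: "is_fctr D C G"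
    and \<eta>: "is_nat_iso C C (comp_fctr G F) id_fctr \<eta>"
    and \<theta>: "is_nat_iso D D (comp_fctr F G) id_fctr \<theta>"
    by (auto simp: is_equivalence_def)
  define GX GY where "GX = fobj G (fobj F X)" and "GY = fobj G (fobj F Y)"
  have obj: "fobj F X \<in> Obj D" "fobj F Y \<in> Obj D" "GX \<in> Obj C" "GY \<in> Obj C"
    unfolding GX_def GY_def by (intro functor_obj[OF G] functor_obj[OF F] X Y)+
  have isoX: "is_iso C GX X (\<eta> X)" and isoY: "is_iso C GY Y (\<eta> Y)"
    using \<eta> X Y by (simp_all add: is_nat_iso_def comp_fctr_def id_fctr_def GX_def GY_def)
  have nat: "Comp C (\<eta> Y) (fmor G (fobj F X) (fobj F Y) (fmor F X Y f)) = Comp C f (\<eta> X)"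
    if "f \<in> Hom C X Y" for f
    using \<eta> X Y that by (simp add: is_nat_iso_def comp_fctr_def id_fctr_def)
  from isoX obtain e where e: "\<eta> X \<in> Hom C GX X" "e \<in> Hom C X GX" "Comp C e (\<eta> X) = Id C GX"
    by (auto simp: is_iso_def)
  have \<eta>Y: "\<eta> Y \<in> Hom C GY Y" using isoY by (simp add: is_iso_def)
  define k where "k = fmor G (fobj F X) (fobj F Y) h"
  have k: "k \<in> Hom C GX GY"
    unfolding k_def GX_def GY_def by (rule functor_hom[OF G obj(1,2) h])
  define f where "f = Comp C (Comp C (\<eta> Y) k) e"
  have \<eta>k: "Comp C (\<eta> Y) k \<in> Hom C GX Y" by (rule cat_comp[OF C obj(3,4) Y k \<eta>Y])
  have f: "f \<in> Hom C X Y" unfolding f_def by (rule cat_comp[OF C X obj(3) Y e(2) \<eta>k])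
  have "Comp C f (\<eta> X) = Comp C (\<eta> Y) k"
    unfolding f_def by (subst cat_assoc[OF C obj(3) X obj(3) Y e(1,2) \<eta>k])
      (simp add: e cat_right_id[OF C obj(3) Y \<eta>k])
  then have "fmor G (fobj F X) (fobj F Y) (fmor F X Y f) = k"
    using nat[OF f] functor_hom[OF G obj(1,2) functor_hom[OF F X Y f]]
    by (intro iso_left_cancel[OF C obj(4) Y obj(3) isoY _ k]) (simp_all add: GX_def GY_def)
  then have "fmor F X Y f = h"
    unfolding k_def
    by (rule faithful_of_retraction[OF D G F \<theta> obj(1,2) functor_hom[OF F X Y f] h])
  with f show ?thesis by blast
qed

lemma equivalence_surj:
  assumes E: "is_equivalence C D F" and Z: "Z \<in> Obj D"
  shows "\<exists>X\<in>Obj C. \<exists>f. is_iso D (fobj F X) Z f"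
proof -
  from E obtain G \<theta> where "is_fctr D C G" and "is_nat_iso D D (comp_fctr F G) id_fctr \<theta>"
    by (auto simp: is_equivalence_def)
  then show ?thesis
    using Z functor_obj[of D C G Z]
    by (auto simp: is_nat_iso_def comp_fctr_def id_fctr_def intro!: bexI[of _ "fobj G Z"])
qed

lemma equivalence_reflects_iso:
  assumes C: "is_category C" and D: "is_category D" and E: "is_equivalence C D F"
    and X: "X \<in> Obj C" and Y: "Y \<in> Obj C" and h: "is_iso D (fobj F X) (fobj F Y) h"
  shows "\<exists>f. is_iso C X Y f"
proof -
  have F: "is_fctr C D F" using E by (simp add: is_equivalence_def)
  from h obtain h' where h': "h \<in> Hom D (fobj F X) (fobj F Y)" "h' \<in> Hom D (fobj F Y) (fobj F X)"
    "Comp D h' h = Id D (fobj F X)" "Comp D h h' = Id D (fobj F Y)"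
    by (auto simp: is_iso_def)
  from equivalence_full[OF C D E X Y h'(1)] equivalence_full[OF C D E Y X h'(2)]
  obtain f f' where f: "f \<in> Hom C X Y" "fmor F X Y f = h" and f': "f' \<in> Hom C Y X" "fmor F Y X f' = h'"
    by blast
  have "Comp C f' f = Id C X"
    using f f' h' X Y
    by (intro equivalence_faithful[OF C E X X])
      (simp_all add: cat_comp[OF C X Y X] cat_id[OF C] functor_comp[OF F X Y X] functor_id[OF F])
  moreover have "Comp C f f' = Id C Y"
    using f f' h' X Y
    by (intro equivalence_faithful[OF C E Y Y])
      (simp_all add: cat_comp[OF C Y X Y] cat_id[OF C] functor_comp[OF F Y X Y] functor_id[OF F])
  ultimately show ?thesis using f f' by (auto simp: is_iso_def)
qed

section \<open>Isomorphism of modules\<close>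

lemma rep_cat_simps [simp]:
  "Obj (rep_cat H) = {V. is_left_module H V}" "Hom (rep_cat H) = module_hom"
  "Id (rep_cat H) V = 1\<^sub>m (fst V)" "Comp (rep_cat H) = (\<lambda>g f. g * f)"
  "Add (rep_cat H) = (\<lambda>f g. f + g)" "Scale (rep_cat H) = (\<lambda>c f. c \<cdot>\<^sub>m f)"
  "TensO (rep_cat H) = tensor_module H" "TensM (rep_cat H) = kron" "UnitO (rep_cat H) = trivial_module H"
  "Assoc (rep_cat H) U V W = 1\<^sub>m (fst U * fst V * fst W)"
  by (simp_all add: rep_cat_def)

lemma is_category_rep_cat: "is_category (rep_cat H)"
  unfolding is_category_def rep_cat_simps
proof (intro conjI ballI)
  fix X Y Z f g
  assume "X \<in> {V. is_left_module H V}" "Y \<in> {V. is_left_module H V}" "Z \<in> {V. is_left_module H V}"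
    and f: "f \<in> module_hom X Y" and g: "g \<in> module_hom Y Z"
  then show "g * f \<in> module_hom X Z" by (intro module_hom_comp[of H X Y Z]) simp_all
next
  fix W X Y Z f g h
  assume "f \<in> module_hom W X" "g \<in> module_hom X Y" "h \<in> module_hom Y Z"
  then show "h * g * f = h * (g * f)" by (intro assoc_mult_mat[OF module_homD(1) module_homD(1) module_homD(1)])
qed (auto intro: module_hom_one left_mult_one_mat right_mult_one_mat dest: module_homD(1))

definition isomorphic :: "('k::field, 'b::finite) hopf \<Rightarrow> ('k, 'b) lmod \<Rightarrow> ('k, 'b) lmod \<Rightarrow> bool" where
  "isomorphic H V W \<longleftrightarrow> (\<exists>f. is_iso (rep_cat H) V W f)"

lemma isomorphic_refl: "is_left_module H V \<Longrightarrow> isomorphic H V V"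
  unfolding isomorphic_def using is_iso_id[OF is_category_rep_cat, of V H] by auto

lemma isomorphic_sym: "isomorphic H V W \<Longrightarrow> isomorphic H W V"
  unfolding isomorphic_def by (metis is_iso_sym)

lemma isomorphic_trans:
  "is_left_module H U \<Longrightarrow> is_left_module H V \<Longrightarrow> is_left_module H W \<Longrightarrow>
    isomorphic H U V \<Longrightarrow> isomorphic H V W \<Longrightarrow> isomorphic H U W"
  unfolding isomorphic_def using is_iso_comp[OF is_category_rep_cat, of U H V W] by auto

lemma isomorphic_tensor:
  assumes V: "is_left_module H V" and W: "is_left_module H W"
    and V': "is_left_module H V'" and W': "is_left_module H W'"
    and "isomorphic H V V'" "isomorphic H W W'"
  shows "isomorphic H (tensor_module H V W) (tensor_module H V' W')"
proof -
  from assms obtain f f' g g' where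
    f: "f \<in> module_hom V V'" "f' \<in> module_hom V' V" "f' * f = 1\<^sub>m (fst V)" "f * f' = 1\<^sub>m (fst V')" and
    g: "g \<in> module_hom W W'" "g' \<in> module_hom W' W" "g' * g = 1\<^sub>m (fst W)" "g * g' = 1\<^sub>m (fst W')"
    by (auto simp: isomorphic_def is_iso_def)
  note c = f(1,2)[THEN module_homD(1)] g(1,2)[THEN module_homD(1)]
  show ?thesis
    unfolding isomorphic_def is_iso_def
    using kron_module_hom[OF V W V' W' f(1) g(1)] kron_module_hom[OF V' W' V W f(2) g(2)]
      kron_mult_kron[OF c(1,2,3,4)] kron_mult_kron[OF c(2,1,4,3)]
    by (intro exI[of _ "kron f g"] conjI bexI[of _ "kron f' g'"]) (simp_all add: f g kron_one)
qed

lemma iso_dim_eq: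
  fixes H :: "('k::field_char_0, 'b::finite) hopf"
  assumes "is_iso (rep_cat H) V W f"
  shows "fst V = fst W"
  using assms mat_inverse_imp_square[of _ "fst V" "fst W"] by (auto simp: is_iso_def module_hom_def)

lemma isomorphic_dim:
  fixes H :: "('k::field_char_0, 'b::finite) hopf"
  shows "isomorphic H V W \<Longrightarrow> fst V = fst W"
  unfolding isomorphic_def using iso_dim_eq by blast

lemma one_dim_iso_nonzero:
  assumes "is_iso (rep_cat H) V W f" "fst V = 1"
  shows "f \<noteq> 0\<^sub>m 1 1"
proof
  assume f: "f = 0\<^sub>m 1 1"
  from assms obtain f' where f': "f' \<in> carrier_mat 1 (fst W)" "f \<in> carrier_mat (fst W) 1" "f' * f = 1\<^sub>m 1"
    by (auto simp: is_iso_def module_hom_def)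
  then have "f' \<in> carrier_mat 1 1" using f by auto
  then have "f' * f = 0\<^sub>m 1 1" unfolding f by (rule right_mult_zero_mat)
  then have "(1\<^sub>m 1 :: 'a Matrix.mat) $$ (0, 0) = 0\<^sub>m 1 1 $$ (0, 0)" using f' by simp
  then show False by simp
qed

section \<open>Modules over an algebra given by generators and relations\<close>

text \<open>
  The linear extension of a function from a basis. Vector and matrix valued evaluations of the free
  algebra are reduced to it entry by entry.
\<close>

definition linear_ext :: "('w \<Rightarrow> 'k::field) \<Rightarrow> ('w \<Rightarrow>\<^sub>0 'k) \<Rightarrow> 'k" where
  "linear_ext \<phi> p = (\<Sum>w\<in>Poly_Mapping.keys p. Poly_Mapping.lookup p w * \<phi> w)"

lemma linear_ext_single [simp]: "linear_ext \<phi> (Poly_Mapping.single w c) = c * \<phi> w"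
  by (simp add: linear_ext_def)

lemma linear_ext_add: "linear_ext \<phi> (p + q) = linear_ext \<phi> p + linear_ext \<phi> q"
  unfolding linear_ext_def by (rule setsum_keys_plus_distrib) (simp_all add: distrib_right)

lemma linear_ext_zero [simp]: "linear_ext \<phi> 0 = 0"
  by (simp add: linear_ext_def)

lemma linear_ext_uminus: "linear_ext \<phi> (- p) = - linear_ext \<phi> p"
  using linear_ext_add[of \<phi> p "- p"] by (simp add: eq_neg_iff_add_eq_0 add.commute)

lemma poly_mapping_monomial_induct [case_names zero single add]:
  fixes p :: "'w \<Rightarrow>\<^sub>0 'k::monoid_add"
  assumes zero: "P 0" and single: "\<And>w c. P (Poly_Mapping.single w c)"
    and add: "\<And>p q. P p \<Longrightarrow> P q \<Longrightarrow> P (p + q)"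
  shows "P p"
proof (induction p rule: update_induct)
  case (update p w c)
  have "Poly_Mapping.update w c p = Poly_Mapping.single w c + p"
    using update(1) by (intro poly_mapping_eqI)
      (auto simp: lookup_update lookup_add lookup_single in_keys_iff when_def)
  then show ?case by (simp add: add single update)
qed (rule zero)

lemma free_eval_index: "free_eval H v p $ i = linear_ext (\<lambda>w. eval_word H v w $ i) p"
  by (simp add: free_eval_def linear_ext_def)

lemma free_eval_zero [simp]: "free_eval H v 0 = 0"
  by (simp add: free_eval_def)

lemma free_eval_add: "free_eval H v (p + q) = free_eval H v p + free_eval H v q"
  by (rule Finite_Cartesian_Product.vec_eq_iff[THEN iffD2]) (simp add: free_eval_index linear_ext_add)

lemma free_eval_single: "free_eval H v (Poly_Mapping.single w c) = c *s eval_word H v w"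
  by (rule Finite_Cartesian_Product.vec_eq_iff[THEN iffD2]) (simp add: free_eval_index)

lemma free_eval_uminus: "free_eval H v (- p) = - free_eval H v p"
  by (rule Finite_Cartesian_Product.vec_eq_iff[THEN iffD2]) (simp add: free_eval_index linear_ext_uminus)

lemma eval_word_simps:
  "eval_word H v (Word []) = hunit H"
  "eval_word H v (Word (i # w)) = hmult H (v i) (eval_word H v (Word w))"
  by (simp_all add: eval_word_def)

context
  fixes H :: "('k::field, 'b::finite) hopf"
  assumes H: "is_algebra H"
begin

lemma hmult_left_lin: "hmult H (a + b) c = hmult H a c + hmult H b c"
    "hmult H (k *s a) c = k *s hmult H a c"
  and hmult_right_lin: "hmult H c (a + b) = hmult H c a + hmult H c b"
    "hmult H c (k *s a) = k *s hmult H c a"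
  and hmult_assoc: "hmult H (hmult H a b) c = hmult H a (hmult H b c)"
  and hmult_unit: "hmult H (hunit H) a = a" "hmult H a (hunit H) = a"
  using H unfolding is_algebra_def
  by (auto dest: linear_addD[of _ _ "\<lambda>a. hmult H a c"] linear_addD[of _ _ "hmult H c"]
    linear_scaleD[of _ _ "\<lambda>a. hmult H a c"] linear_scaleD[of _ _ "hmult H c"])

lemma eval_word_plus: "eval_word H v (u + w) = hmult H (eval_word H v u) (eval_word H v w)"
proof (cases u)
  case (Word l)
  show ?thesis unfolding Word plus_word_def
    by (induction l) (simp_all add: eval_word_simps hmult_unit hmult_assoc)
qed

lemma free_eval_mult: "free_eval H v (p * q) = hmult H (free_eval H v p) (free_eval H v q)"
proof (induction p rule: poly_mapping_monomial_induct)
  case zero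
  show ?case using hmult_left_lin(2)[of 0 0] by simp
next
  case (single w c)
  show ?case
  proof (induction q rule: poly_mapping_monomial_induct)
    case zero
    show ?case using hmult_right_lin(2)[of _ 0 0] by simp
  qed (simp_all add: mult_single free_eval_single eval_word_plus hmult_left_lin hmult_right_lin
      distrib_left free_eval_add ac_simps vector_smult_assoc)
qed (simp add: distrib_right free_eval_add hmult_left_lin)

end

definition word_mat :: "nat \<Rightarrow> ('x \<Rightarrow> 'k::field Matrix.mat) \<Rightarrow> 'x word \<Rightarrow> 'k Matrix.mat" where
  "word_mat n M w = foldr (\<lambda>i A. M i * A) (letters w) (1\<^sub>m n)"

text \<open>
  The algebra map from the free algebra to the \<open>n\<close> by \<open>n\<close> matrices that sends the generators to \<open>M\<close>.
\<close>

definition mat_eval :: "nat \<Rightarrow> ('x \<Rightarrow> 'k::field Matrix.mat) \<Rightarrow> ('k, 'x) free_algebra \<Rightarrow> 'k Matrix.mat" where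
  "mat_eval n M p = Matrix.mat n n (\<lambda>ij. linear_ext (\<lambda>w. word_mat n M w $$ ij) p)"

lemma mat_eval_carrier [simp]: "mat_eval n M p \<in> carrier_mat n n"
  by (simp add: mat_eval_def)

lemma dim_mat_eval [simp]: "dim_row (mat_eval n M p) = n" "dim_col (mat_eval n M p) = n"
  by (simp_all add: mat_eval_def)

lemma mat_eval_add: "mat_eval n M (p + q) = mat_eval n M p + mat_eval n M q"
  and mat_eval_uminus: "mat_eval n M (- p) = - mat_eval n M p"
  and mat_eval_zero: "mat_eval n M 0 = 0\<^sub>m n n"
  by (rule eq_matI; simp add: mat_eval_def linear_ext_add linear_ext_uminus)+

lemma mat_eval_diff: "mat_eval n M (p - q) = mat_eval n M p - mat_eval n M q"
  using mat_eval_add[of n M p "- q"] mat_eval_uminus[of n M q]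
  by (simp add: minus_add_uminus_mat[of _ n n])

lemma word_mat_simps:
  "word_mat n M (Word []) = 1\<^sub>m n"
  "word_mat n M (Word (i # w)) = M i * word_mat n M (Word w)"
  by (simp_all add: word_mat_def)

context
  fixes n :: nat and M :: "'x \<Rightarrow> 'k::field Matrix.mat"
  assumes M: "\<And>i. M i \<in> carrier_mat n n"
begin

lemma word_mat_carrier [simp]: "word_mat n M w \<in> carrier_mat n n"
proof (cases w)
  case (Word l)
  show ?thesis unfolding Word
    by (induction l) (auto simp: word_mat_simps intro: mult_carrier_mat M)
qed

lemma word_mat_plus: "word_mat n M (u + w) = word_mat n M u * word_mat n M w"
proof (cases u)
  case (Word l)
  show ?thesis unfolding Word plus_word_def
  proof (induction l)
    case Nil
    show ?case by (cases w) (simp add: word_mat_simps left_mult_one_mat[OF word_mat_carrier])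
  next
    case (Cons i l)
    then show ?case
      by (simp add: word_mat_simps assoc_mult_mat[OF M word_mat_carrier word_mat_carrier])
  qed
qed

lemma mat_eval_single: "mat_eval n M (Poly_Mapping.single w c) = c \<cdot>\<^sub>m word_mat n M w"
  by (rule eq_matI) (use carrier_matD[OF word_mat_carrier[of w]] in \<open>simp_all add: mat_eval_def\<close>)

lemma mat_eval_gen: "mat_eval n M (gen i) = M i"
  by (simp add: gen_def mat_eval_single word_mat_simps right_mult_one_mat[OF M] one_smult_mat)

lemma mat_eval_scalar: "mat_eval n M (scalar c) = c \<cdot>\<^sub>m 1\<^sub>m n"
  by (simp add: scalar_def mat_eval_single zero_word_def word_mat_simps)

lemma mat_eval_one: "mat_eval n M 1 = 1\<^sub>m n"
  unfolding single_one[symmetric] mat_eval_single zero_word_def word_mat_simps by (rule eq_matI) simp_all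

lemma mat_eval_mult: "mat_eval n M (p * q) = mat_eval n M p * mat_eval n M q"
proof (induction p rule: poly_mapping_monomial_induct)
  case zero
  show ?case by (simp add: mat_eval_zero left_mult_zero_mat[OF mat_eval_carrier])
next
  case (single w c)
  show ?case
  proof (induction q rule: poly_mapping_monomial_induct)
    case zero
    show ?case by (simp add: mat_eval_zero right_mult_zero_mat[OF mat_eval_carrier])
  next
    case (single u d)
    have "c * d \<cdot>\<^sub>m (word_mat n M w * word_mat n M u) = (c \<cdot>\<^sub>m word_mat n M w) * (d \<cdot>\<^sub>m word_mat n M u)"
      by (simp add: mult_smult_assoc_mat[OF word_mat_carrier smult_carrier_mat[OF word_mat_carrier]]
          mult_smult_distrib[OF word_mat_carrier word_mat_carrier] smult_smult_mat mult.commute)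
    then show ?case by (simp add: mult_single mat_eval_single word_mat_plus)
  next
    case (add p q)
    then show ?case
      by (simp add: distrib_left mat_eval_add mult_add_distrib_mat[OF mat_eval_carrier mat_eval_carrier mat_eval_carrier])
  qed
next
  case (add p q)
  then show ?case
    by (simp add: distrib_right mat_eval_add add_mult_distrib_mat[OF mat_eval_carrier mat_eval_carrier mat_eval_carrier])
qed

lemma mat_eval_power: "mat_eval n M (p ^ k) = mat_eval n M p ^\<^sub>m k"
  by (induction k) (simp_all add: mat_eval_one mat_eval_mult power_Suc2 del: power_Suc)

lemma mat_eval_ideal_gen:
  assumes "\<And>r. r \<in> R \<Longrightarrow> mat_eval n M r = 0\<^sub>m n n" and "p \<in> ideal_gen R"
  shows "mat_eval n M p = 0\<^sub>m n n"
  using assms(2)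
  by induction (simp_all add: assms(1) mat_eval_zero mat_eval_add mat_eval_mult
      left_mult_zero_mat[OF mat_eval_carrier] right_mult_zero_mat[OF mat_eval_carrier])

end

lemma module_free_eval:
  fixes H :: "('k::field, 'b::finite) hopf"
  assumes V: "is_left_module H V"
  shows "snd V (free_eval H v p) = mat_eval (fst V) (\<lambda>i. snd V (v i)) p"
proof -
  note M = module_carrier[OF V]
  have word: "snd V (eval_word H v (Word l)) = word_mat (fst V) (\<lambda>i. snd V (v i)) (Word l)" for l
    by (induction l) (simp_all add: eval_word_simps word_mat_simps module_unit[OF V] module_mult[OF V])
  show ?thesis
  proof (induction p rule: poly_mapping_monomial_induct)
    case zero
    show ?case by (simp add: mat_eval_zero module_zero[OF V])
  next
    case (single w c)
    then show ?case
      by (cases w) (simp add: free_eval_single module_smult[OF V] word mat_eval_single[of "\<lambda>i. snd V (v i)", OF M])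
  qed (simp add: free_eval_add mat_eval_add module_add[OF V])
qed

context
  fixes H :: "('k::field, 'b::finite) hopf" and v :: "'x \<Rightarrow> 'k^'b" and R :: "('k, 'x) free_algebra set"
  assumes pres: "presented_by H v R"
begin

lemma generation_induct:
  assumes unit: "P (hunit H)" and gen: "\<And>i a. P a \<Longrightarrow> P (hmult H (v i) a)"
    and add: "\<And>a b. P a \<Longrightarrow> P b \<Longrightarrow> P (a + b)" and smult: "\<And>c a. P a \<Longrightarrow> P (c *s a)"
  shows "P a"
proof -
  have word: "P (eval_word H v (Word l))" for l
    by (induction l) (simp_all add: eval_word_simps unit gen)
  have "P 0" using smult[OF unit, of 0] by simp
  moreover have "P (eval_word H v w)" for w using word by (cases w) simp
  ultimately have "P (free_eval H v p)" for p
    by (induction p rule: poly_mapping_monomial_induct) (simp_all add: free_eval_single free_eval_add add smult)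
  then show ?thesis using pres by (metis presented_by_def surjD)
qed

lemma module_homI_gen:
  assumes V: "is_left_module H V" and W: "is_left_module H W"
    and f: "f \<in> carrier_mat (fst W) (fst V)" and gens: "\<And>i. f * snd V (v i) = snd W (v i) * f"
  shows "f \<in> module_hom V W"
proof -
  note cV = module_carrier[OF V] and cW = module_carrier[OF W]
  have "f * snd V a = snd W a * f" for a
  proof (induction a rule: generation_induct)
    case 1
    show ?case by (simp add: module_unit[OF V] module_unit[OF W] left_mult_one_mat[OF f] right_mult_one_mat[OF f])
  next
    case (2 i a)
    have "f * snd V (hmult H (v i) a) = f * snd V (v i) * snd V a"
      by (simp add: module_mult[OF V] assoc_mult_mat[OF f cV cV])
    also have "\<dots> = snd W (v i) * (f * snd V a)"
      by (simp only: gens assoc_mult_mat[OF cW f cV])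
    also have "\<dots> = snd W (hmult H (v i) a) * f"
      by (simp only: 2 module_mult[OF W] assoc_mult_mat[OF cW cW f])
    finally show ?case .
  next
    case (3 a b)
    then show ?case
      by (simp add: module_add[OF V] module_add[OF W] mult_add_distrib_mat[OF f cV cV] add_mult_distrib_mat[OF cW cW f])
  next
    case (4 c a)
    then show ?case
      by (simp add: module_smult[OF V] module_smult[OF W] mult_smult_distrib[OF f cV] mult_smult_assoc_mat[OF cW f])
  qed
  with f show ?thesis by (simp add: module_hom_def)
qed

lemma module_eqI_gen:
  assumes V: "is_left_module H V" and W: "is_left_module H W"
    and dim: "fst V = fst W" and gens: "\<And>i. snd V (v i) = snd W (v i)"
  shows "V = W"
proof -
  have "1\<^sub>m (fst W) \<in> module_hom V W"
    by (rule module_homI_gen[OF V W])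
      (simp_all add: dim gens left_mult_one_mat[OF module_carrier[OF W]] right_mult_one_mat[OF module_carrier[OF W]])
  then have "1\<^sub>m (fst W) * snd V a = snd W a * 1\<^sub>m (fst W)" for a by (rule module_homD)
  then have "snd V a = snd W a" for a
    by (simp add: right_mult_one_mat[OF module_carrier[OF W]]
        left_mult_one_mat[OF module_carrier[OF V, unfolded dim]])
  then show ?thesis using dim by (intro prod_eqI ext)
qed

text \<open>
  Together with the converse \<open>module_of_matrices\<close>, this identifies modules over the presented algebra
  with tuples of matrices that satisfy the relations.
\<close>

lemma relator_acts_zero:
  assumes V: "is_left_module H V" and r: "r \<in> R"
  shows "mat_eval (fst V) (\<lambda>i. snd V (v i)) r = 0\<^sub>m (fst V) (fst V)"
proof -
  have "free_eval H v r = 0" using pres ideal_gen.base[OF r] by (simp add: presented_by_def)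
  then show ?thesis using module_free_eval[OF V, of v r] by (simp add: module_zero[OF V])
qed

text \<open>
  Evaluation of the free algebra at \<open>M\<close> kills the ideal of relations, so it factors through \<open>H\<close>.
\<close>

lemma module_of_matrices:
  assumes alg: "is_algebra H" and M: "\<And>i. M i \<in> carrier_mat n n"
    and rel: "\<And>r. r \<in> R \<Longrightarrow> mat_eval n M r = 0\<^sub>m n n"
  shows "\<exists>V. is_left_module H V \<and> fst V = n \<and> (\<forall>i. snd V (v i) = M i)"
proof -
  \<comment> \<open>A chosen preimage in the free algebra; the action does not depend on the choice.\<close>
  define pre where "pre a = (SOME p. free_eval H v p = a)" for a
  have pre: "free_eval H v (pre a) = a" for a
    unfolding pre_def using pres by (metis (mono_tags, lifting) presented_by_def surjD someI)
  have eq: "mat_eval n M p = mat_eval n M q" if "free_eval H v p = free_eval H v q" for p q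
  proof -
    have "free_eval H v (p - q) = 0"
      using that free_eval_add[of H v p "- q"] by (simp add: free_eval_uminus)
    then have "mat_eval n M (p - q) = 0\<^sub>m n n"
      using pres mat_eval_ideal_gen[OF M rel] by (simp add: presented_by_def)
    then show ?thesis
      using mat_eval_add[of n M "p - q" q] by (simp add: left_add_zero_mat[OF mat_eval_carrier])
  qed
  define V where "V = (n, \<lambda>a. mat_eval n M (pre a))"
  have sndV: "snd V a = mat_eval n M p" if "free_eval H v p = a" for a p
    unfolding V_def using eq[of "pre a" p] that by (simp add: pre)
  have "is_left_module H V"
  proof (rule is_left_moduleI)
    fix a b :: "'k^'b" and c :: 'k
    show "snd V a \<in> carrier_mat (fst V) (fst V)" by (simp add: V_def)
    show "snd V (a + b) = snd V a + snd V b"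
      by (subst sndV[of "pre a + pre b"]) (simp_all add: free_eval_add pre mat_eval_add V_def)
    have "free_eval H v (scalar c) = c *s hunit H"
      by (simp add: scalar_def free_eval_single zero_word_def eval_word_simps)
    then show "snd V (c *s a) = c \<cdot>\<^sub>m snd V a"
      by (subst sndV[of "scalar c * pre a"])
        (simp_all add: free_eval_mult[OF alg] pre mat_eval_mult[OF M] mat_eval_scalar[OF M] V_def
          hmult_left_lin[OF alg] hmult_unit[OF alg] mult_smult_assoc_mat[OF one_carrier_mat mat_eval_carrier]
          left_mult_one_mat[OF mat_eval_carrier])
    show "snd V (hmult H a b) = snd V a * snd V b"
      by (subst sndV[of "pre a * pre b"]) (simp_all add: free_eval_mult[OF alg] pre mat_eval_mult[OF M] V_def)
    have "free_eval H v 1 = hunit H"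
      unfolding single_one[symmetric] by (simp add: free_eval_single zero_word_def eval_word_simps)
    then show "snd V (hunit H) = 1\<^sub>m (fst V)"
      by (subst sndV[of 1]) (simp_all add: mat_eval_one[OF M] V_def)
  qed
  moreover have "snd V (v i) = M i" for i
    by (subst sndV[of "gen i"]) (simp_all add: gen_def free_eval_single eval_word_simps hmult_unit[OF alg]
        mat_eval_gen[OF M, unfolded gen_def])
  ultimately show ?thesis by (intro exI[of _ V]) (simp add: V_def)
qed

end

section \<open>Characters and the two-dimensional extension\<close>

lemma is_algebra_hopf: "is_hopf_algebra H \<Longrightarrow> is_algebra H"
  by (simp add: is_hopf_algebra_def)

lemma scalar_minus_one: "scalar (- 1) = (- 1 :: ('k::field, 'x) free_algebra)"
  by (simp add: scalar_def single_uminus)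

definition is_char :: "('k::field, 'b::finite) hopf \<Rightarrow> 'k^'b \<Rightarrow> 'k^'b \<Rightarrow> ('k, 'b) lmod \<Rightarrow> 'k \<Rightarrow> bool" where
  "is_char H g x V \<kappa> \<longleftrightarrow> is_left_module H V \<and> fst V = 1 \<and> snd V g = \<kappa> \<cdot>\<^sub>m 1\<^sub>m 1 \<and> snd V x = 0\<^sub>m 1 1"

lemma is_charD:
  "is_char H g x V \<kappa> \<Longrightarrow> is_left_module H V" "is_char H g x V \<kappa> \<Longrightarrow> fst V = 1"
  "is_char H g x V \<kappa> \<Longrightarrow> snd V g = \<kappa> \<cdot>\<^sub>m 1\<^sub>m 1" "is_char H g x V \<kappa> \<Longrightarrow> snd V x = 0\<^sub>m 1 1"
  by (simp_all add: is_char_def)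

lemma tensor_grouplike:
  assumes "comult H g = g \<otimes>\<^sub>v g" "is_left_module H V" "is_left_module H W"
  shows "snd (tensor_module H V W) g = kron (snd V g) (snd W g)"
  using assms by (simp add: snd_tensor_module tensor_action_tens)

text \<open>
  A nonzero map between one-dimensional modules is invertible, so it matches the actions of \<open>g\<close>.
\<close>

lemma char_hom_eq:
  assumes V: "is_char H g x V \<kappa>" and W: "is_char H g x W \<mu>" and f: "f \<in> module_hom V W"
    and nz: "f \<noteq> 0\<^sub>m 1 1"
  shows "\<kappa> = \<mu>"
proof -
  have c: "f \<in> carrier_mat 1 1" using module_homD(1)[OF f] V W by (simp add: is_char_def)
  then have f1: "f = f $$ (0, 0) \<cdot>\<^sub>m 1\<^sub>m 1" by (rule mat_1x1)
  then have f0: "f $$ (0, 0) \<noteq> 0" using nz by (auto simp: smult_zero_mat)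
  have "f * (\<kappa> \<cdot>\<^sub>m 1\<^sub>m 1) = (\<mu> \<cdot>\<^sub>m 1\<^sub>m 1) * f"
    using module_homD(2)[OF f, of g] is_charD(3)[OF V] is_charD(3)[OF W] by simp
  then have "(f $$ (0, 0) * \<kappa>) \<cdot>\<^sub>m 1\<^sub>m 1 = (\<mu> * f $$ (0, 0)) \<cdot>\<^sub>m (1\<^sub>m 1 :: 'a Matrix.mat)"
    using f1 by (metis scalar_mat_mult)
  then show ?thesis using f0 by (simp add: scalar_mat_1_eq_iff del: One_nat_def)
qed

lemma char_isomorphic_eq:
  assumes "is_char H g x V \<kappa>" "is_char H g x W \<mu>" "isomorphic H V W"
  shows "\<kappa> = \<mu>"
proof -
  from assms(3) obtain f where f: "is_iso (rep_cat H) V W f" by (auto simp: isomorphic_def)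
  then show ?thesis
    using char_hom_eq[OF assms(1,2), of f] one_dim_iso_nonzero[OF f is_charD(2)[OF assms(1)]]
    by (simp add: is_iso_def)
qed

locale gx_generated =
  fixes H :: "('k::field, 'b::finite) hopf" and g x :: "'k^'b" and R :: "('k, gx) free_algebra set"
  assumes gx: "gx_hopf H g x R" and comult_g: "comult H g = g \<otimes>\<^sub>v g"
begin

abbreviation "v \<equiv> (\<lambda>i. case i of Gg \<Rightarrow> g | Gx \<Rightarrow> x)"

lemma hopf: "is_hopf_algebra H" and pres: "presented_by H v R"
  and counit_gx: "counit H g = 1" "counit H x = 0"
  using gx by (simp_all add: gx_hopf_def)

lemma tensor_is_module [intro]:
  "is_left_module H V \<Longrightarrow> is_left_module H W \<Longrightarrow> is_left_module H (tensor_module H V W)"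
  by (rule is_left_module_tensor[OF hopf])

lemma relation:
  assumes V: "is_left_module H V" and r: "p - q \<in> R"
  shows "mat_eval (fst V) (\<lambda>i. snd V (v i)) p = mat_eval (fst V) (\<lambda>i. snd V (v i)) q"
  by (rule minus_mat_eq_0D[OF mat_eval_carrier mat_eval_carrier])
    (simp add: mat_eval_diff[symmetric] relator_acts_zero[OF pres V r])

lemma mat_eval_module:
  assumes V: "is_left_module H V"
  defines "ev \<equiv> mat_eval (fst V) (\<lambda>i. snd V (v i))"
  shows "ev fG = snd V g" "ev fX = snd V x" "ev (p * q) = ev p * ev q" "ev (p ^ k) = ev p ^\<^sub>m k"
    "ev 1 = 1\<^sub>m (fst V)" "ev (scalar a) = a \<cdot>\<^sub>m 1\<^sub>m (fst V)"
proof -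
  have M: "snd V (v i) \<in> carrier_mat (fst V) (fst V)" for i by (rule module_carrier[OF V])
  show "ev fG = snd V g" "ev fX = snd V x" "ev (p * q) = ev p * ev q" "ev (p ^ k) = ev p ^\<^sub>m k"
    "ev 1 = 1\<^sub>m (fst V)" "ev (scalar a) = a \<cdot>\<^sub>m 1\<^sub>m (fst V)"
    using mat_eval_gen[of "\<lambda>i. snd V (v i)", OF M]
    by (simp_all add: ev_def mat_eval_mult[of "\<lambda>i. snd V (v i)", OF M] mat_eval_power[of "\<lambda>i. snd V (v i)", OF M]
      mat_eval_one[of "\<lambda>i. snd V (v i)", OF M] mat_eval_scalar[of "\<lambda>i. snd V (v i)", OF M])
qed

lemma module_eqI:
  assumes "is_left_module H V" "is_left_module H W" "fst V = fst W" "snd V g = snd W g" "snd V x = snd W x"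
  shows "V = W"
  by (rule module_eqI_gen[OF pres]) (use assms in \<open>auto split: gx.split\<close>)

lemma module_homI:
  assumes "is_left_module H V" "is_left_module H W" "f \<in> carrier_mat (fst W) (fst V)"
    "f * snd V g = snd W g * f" "f * snd V x = snd W x * f"
  shows "f \<in> module_hom V W"
  by (rule module_homI_gen[OF pres]) (use assms in \<open>auto split: gx.split\<close>)

lemma char_eqI: "is_char H g x V \<kappa> \<Longrightarrow> is_char H g x W \<kappa> \<Longrightarrow> V = W"
  by (rule module_eqI) (simp_all add: is_char_def)

lemma char_trivial: "is_char H g x (trivial_module H) 1"
  unfolding is_char_def snd_trivial_module counit_gx
  using is_left_module_trivial[OF hopf] by (auto intro!: eq_matI)

end

text \<open>
  The second basis vector spans a submodule with character \<open>c\<close>, and the quotient by it is trivial.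
\<close>

definition is_extension :: "('k::field, 'b::finite) hopf \<Rightarrow> 'k^'b \<Rightarrow> 'k^'b \<Rightarrow> 'k \<Rightarrow> ('k, 'b) lmod \<Rightarrow> bool" where
  "is_extension H g x c P \<longleftrightarrow>
     is_left_module H P \<and> fst P = 2 \<and> snd P g = mat2 1 0 0 c \<and> snd P x = mat2 0 0 1 0"

text \<open>
  Commuting with \<open>diag(1, c)\<close> forces \<open>f\<close> to be diagonal as \<open>c \<noteq> 1\<close>, and the second equation relates
  the two diagonal entries. For \<open>\<kappa> = 1\<close> this computes the endomorphisms of the extension, in general
  its homomorphisms to a twist by a character.
\<close>

lemma extension_hom_form:
  assumes f: "f \<in> carrier_mat 2 2" and "c \<noteq> 1"
    and g: "f * mat2 1 0 0 c = mat2 1 0 0 c * f" and x: "f * mat2 0 0 1 0 = (\<kappa> \<cdot>\<^sub>m mat2 0 0 1 0) * f"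
  shows "f = f $$ (0, 0) \<cdot>\<^sub>m mat2 1 0 0 (\<kappa> :: 'k::field)"
proof -
  obtain p q r s where f': "f = mat2 p q r s" using eq_mat2I[OF f] by blast
  have "q * c = q" "r = c * r" "s = \<kappa> * p"
    using g x by (auto simp: f' mat2_mult mat2_smult mat2_eq_iff)
  then have "q = 0" "r = 0" using \<open>c \<noteq> 1\<close> by auto
  then show ?thesis using \<open>s = \<kappa> * p\<close> by (simp add: f' mat2_smult mult.commute)
qed

text \<open>
  The common form of the algebras \<open>A\<^sub>0\<close>, \<open>B\<^sub>0\<close> and \<open>B\<^sub>1\<close>.
\<close>

locale skew_hopf = gx_generated H g x "{fG ^ 6 - 1, fX ^ 2, fG * fX - scalar c * fX * fG}"
  for H :: "('k::field, 'b::finite) hopf" and g x c +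
  fixes N :: nat
  assumes c6: "c ^ 6 = 1"
    and comult_x: "comult H x = x \<otimes>\<^sub>v hunit H + ((hmult H g ^^ N) (hunit H)) \<otimes>\<^sub>v x"
begin

context
  fixes V :: "('k, 'b) lmod"
  assumes V: "is_left_module H V"
begin

lemma x_square: "snd V x * snd V x = 0\<^sub>m (fst V) (fst V)"
  and g_x_commute: "snd V g * snd V x = c \<cdot>\<^sub>m (snd V x * snd V g)"
proof -
  note X = module_carrier[OF V, of x] and G = module_carrier[OF V, of g]
  show "snd V x * snd V x = 0\<^sub>m (fst V) (fst V)"
    using relation[OF V, of "fX ^ 2" 0]
    by (simp only: power2_eq_square mat_eval_module[OF V] mat_eval_zero) simp
  show "snd V g * snd V x = c \<cdot>\<^sub>m (snd V x * snd V g)"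
    using relation[OF V, of "fG * fX" "scalar c * fX * fG"]
    by (simp add: mat_eval_module[OF V] mult_smult_assoc_mat[OF one_carrier_mat X]
        mult_smult_assoc_mat[OF X G] left_mult_one_mat[OF X])
qed

lemma module_g_power: "snd V ((hmult H g ^^ k) (hunit H)) = snd V g ^\<^sub>m k"
proof (induction k)
  case (Suc k)
  have "snd V g * snd V g ^\<^sub>m k = snd V g ^\<^sub>m k * snd V g"
    by (rule pow_mat_commute[OF module_carrier[OF V]])
  then show ?case by (simp add: module_mult[OF V] Suc)
qed (simp add: module_unit[OF V] carrier_matD[OF module_carrier[OF V]])

end

lemma module_exists:
  assumes "G \<in> carrier_mat n n" "X \<in> carrier_mat n n"
    and "G ^\<^sub>m 6 = 1\<^sub>m n" "X * X = 0\<^sub>m n n" "G * X = c \<cdot>\<^sub>m (X * G)"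
  shows "\<exists>V. is_left_module H V \<and> fst V = n \<and> snd V g = G \<and> snd V x = X"
proof -
  let ?M = "\<lambda>i. case i of Gg \<Rightarrow> G | Gx \<Rightarrow> X"
  have M: "?M i \<in> carrier_mat n n" for i using assms(1,2) by (cases i) simp_all
  have gens: "mat_eval n ?M fG = G" "mat_eval n ?M fX = X"
    using mat_eval_gen[of ?M, OF M, of Gg] mat_eval_gen[of ?M, OF M, of Gx] by simp_all
  have GX: "G * X \<in> carrier_mat n n" using assms(1,2) by (rule mult_carrier_mat)
  have "\<exists>V. is_left_module H V \<and> fst V = n \<and> (\<forall>i. snd V (v i) = ?M i)"
  proof (rule module_of_matrices[OF pres is_algebra_hopf[OF hopf] M])
    fix r :: "('k, gx) free_algebra"
    assume "r \<in> {fG ^ 6 - 1, fX ^ 2, fG * fX - scalar c * fX * fG}"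
    then consider "r = fG ^ 6 - 1" | "r = fX ^ 2" | "r = fG * fX - scalar c * fX * fG" by blast
    then show "mat_eval n ?M r = 0\<^sub>m n n"
    proof cases
      case 1
      then show ?thesis
        by (simp add: mat_eval_diff mat_eval_power[of ?M, OF M] mat_eval_one[of ?M, OF M] gens assms(3)
            minus_mat_self[OF one_carrier_mat])
    next
      case 2
      then show ?thesis by (simp add: power2_eq_square mat_eval_mult[of ?M, OF M] gens assms(4))
    next
      case 3
      then show ?thesis
        by (simp add: mat_eval_diff mat_eval_mult[of ?M, OF M] gens mat_eval_scalar[of ?M, OF M]
            mult_smult_assoc_mat[OF one_carrier_mat assms(2)] mult_smult_assoc_mat[OF assms(2,1)]
            left_mult_one_mat[OF assms(2)] assms(5)[symmetric] minus_mat_self[OF GX])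
    qed
  qed
  then show ?thesis by (metis gx.case)
qed

lemma tensor_x:
  assumes "is_left_module H V" "is_left_module H W"
  shows "snd (tensor_module H V W) x = kron (snd V x) (1\<^sub>m (fst W)) + kron (snd V g ^\<^sub>m N) (snd W x)"
  using assms by (simp add: snd_tensor_module comult_x tensor_action_add tensor_action_tens module_unit
      module_g_power)

lemma char_exists: "\<kappa> ^ 6 = 1 \<Longrightarrow> \<exists>V. is_char H g x V \<kappa>"
  unfolding is_char_def using module_exists[of "\<kappa> \<cdot>\<^sub>m 1\<^sub>m 1" 1 "0\<^sub>m 1 1"]
  by (auto simp: scalar_mat_power one_smult_mat simp del: One_nat_def)

text \<open>
  On a one-dimensional module \<open>x\<close> acts by a scalar of square zero.
\<close>

lemma char_of_one_dim:
  assumes "is_left_module H V" "fst V = 1"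
  shows "\<exists>\<kappa>. is_char H g x V \<kappa>"
proof -
  have c: "snd V a \<in> carrier_mat 1 1" for a using module_carrier[OF assms(1)] by (simp add: assms(2))
  define \<kappa> \<xi> where "\<kappa> = snd V g $$ (0, 0)" and "\<xi> = snd V x $$ (0, 0)"
  have gx: "snd V g = \<kappa> \<cdot>\<^sub>m 1\<^sub>m 1" "snd V x = \<xi> \<cdot>\<^sub>m 1\<^sub>m 1"
    unfolding \<kappa>_def \<xi>_def by (rule mat_1x1[OF c])+
  have zero: "0\<^sub>m 1 1 = 0 \<cdot>\<^sub>m (1\<^sub>m 1 :: 'k Matrix.mat)" by (rule eq_matI) simp_all
  have "\<xi> * \<xi> = 0"
    using x_square[OF assms(1)] by (simp add: gx scalar_mat_mult assms(2) zero scalar_mat_1_eq_iff del: One_nat_def)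
  then show ?thesis using assms gx zero by (auto simp: is_char_def)
qed

lemma char_tensor:
  assumes "is_char H g x V \<kappa>" "is_char H g x W \<mu>"
  shows "is_char H g x (tensor_module H V W) (\<kappa> * \<mu>)"
proof -
  note V = is_charD[OF assms(1)] and W = is_charD[OF assms(2)]
  have "snd (tensor_module H V W) g = (\<kappa> * \<mu>) \<cdot>\<^sub>m 1\<^sub>m 1"
    using tensor_grouplike[OF comult_g V(1) W(1)] by (simp add: V W kron_smult_left smult_smult_mat del: One_nat_def)
  moreover have "snd (tensor_module H V W) x = 0\<^sub>m 1 1"
    using tensor_x[OF V(1) W(1)]
    by (simp add: V W scalar_mat_power kron_smult_left kron_scalar_left[OF zero_carrier_mat] smult_zero_mat del: One_nat_def)
  ultimately show ?thesis using V W by (simp add: is_char_def tensor_is_module)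
qed

lemma extension_exists: "\<exists>P. is_extension H g x c P"
  unfolding is_extension_def using module_exists[of "mat2 1 0 0 c" 2 "mat2 0 0 1 0"]
  by (simp add: mat2_diag_power c6 mat2_one mat2_zero mat2_mult mat2_smult)

lemma extension_inclusion:
  assumes P: "is_extension H g x c P" and S: "is_char H g x S c"
  shows "col2 0 1 \<in> module_hom S P"
  using assms by (intro module_homI)
    (auto simp: is_extension_def is_char_def mat2_col2 col2_row2_smult
      mult_smult_distrib[OF col2_carrier(1) one_carrier_mat] right_mult_one_mat[OF col2_carrier(1)]
      right_mult_zero_mat[OF col2_carrier(1)] col2_row2_zero simp del: One_nat_def)

lemma extension_projection:
  assumes P: "is_extension H g x c P" and I: "is_char H g x I 1"
  shows "row2 1 0 \<in> module_hom P I"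
  using assms by (intro module_homI)
    (auto simp: is_extension_def is_char_def row2_mat2 one_smult_mat
      left_mult_one_mat[OF row2_carrier(1)] left_mult_zero_mat[OF row2_carrier(1)] col2_row2_zero simp del: One_nat_def)

end

lemma skew_hopf_of_A0: "is_A0 H g x \<Longrightarrow> skew_hopf H g x (- 1) 1"
  and skew_hopf_of_B0: "is_B0 H g x \<Longrightarrow> skew_hopf H g x (- 1) 3"
  and skew_hopf_of_B1: "is_B1 c H g x \<Longrightarrow> c ^ 6 = 1 \<Longrightarrow> skew_hopf H g x c 3"
  using scalar_minus_one[where 'k = 'a and 'x = gx]
  by (auto simp: skew_hopf_def skew_hopf_axioms_def gx_generated_def is_A0_def is_B0_def is_B1_def gx_hopf_def
      hmult_unit is_algebra_hopf eval_nat_numeral)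

text \<open>
  In the coproduct of \<open>x\<close> the factor \<open>g\<^sup>N\<close> acts trivially on \<open>T\<close>, hence \<open>x\<close> acts on both products
  as it does on \<open>V\<close>.
\<close>

lemma tensor_commute_char:
  assumes "skew_hopf K h y d N" and V: "is_left_module K V" and T: "is_char K h y T \<mu>" and "\<mu> ^ N = 1"
  shows "tensor_module K V T = tensor_module K T V"
proof -
  interpret skew_hopf K h y d N by fact
  note T' = is_charD[OF T]
  show ?thesis
  proof (rule module_eqI)
    note Vx = module_carrier[OF V, of y]
    have z: "kron (snd V h ^\<^sub>m N) (0\<^sub>m 1 1) = 0\<^sub>m (fst V) (fst V)"
      using pow_carrier_mat[OF module_carrier[OF V, of h], of N]
      by (simp add: kron_scalar_right[OF zero_carrier_mat] zero_smult_mat del: One_nat_def)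
    have z': "kron (0\<^sub>m 1 1) (1\<^sub>m (fst V)) = (0\<^sub>m (fst V) (fst V) :: 'a Matrix.mat)"
      by (simp add: kron_scalar_left[OF zero_carrier_mat] zero_smult_mat[OF one_carrier_mat] del: One_nat_def)
    show "snd (tensor_module K V T) y = snd (tensor_module K T V) y"
      by (simp add: tensor_x[OF V T'(1)] tensor_x[OF T'(1) V] T' z z' scalar_mat_power assms(4) one_smult_mat
          right_add_zero_mat[OF Vx] left_add_zero_mat[OF Vx] del: One_nat_def)
    show "snd (tensor_module K V T) h = snd (tensor_module K T V) h"
      by (simp add: tensor_grouplike[OF comult_g V T'(1)] tensor_grouplike[OF comult_g T'(1) V] T'
          kron_smult_left kron_smult_right del: One_nat_def)
  qed (use V T' in \<open>auto intro: tensor_is_module\<close>)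
qed

section \<open>What a tensor equivalence preserves\<close>

definition scalar_endomorphisms :: "('k::field, 'b::finite) lmod \<Rightarrow> bool" where
  "scalar_endomorphisms V \<longleftrightarrow> (\<forall>f\<in>module_hom V V. \<exists>c. f = c \<cdot>\<^sub>m 1\<^sub>m (fst V))"

definition nonzero_hom :: "('k::field, 'b::finite) lmod \<Rightarrow> ('k, 'b) lmod \<Rightarrow> bool" where
  "nonzero_hom V W \<longleftrightarrow> (\<exists>f\<in>module_hom V W. f \<noteq> 0\<^sub>m (fst W) (fst V))"

locale tensor_equivalence =
  fixes H :: "('k::field_char_0, 'b::finite) hopf" and K :: "('k, 'c::finite) hopf"
    and F :: "(('k, 'b) lmod, 'k Matrix.mat, ('k, 'c) lmod, 'k Matrix.mat) fctr"
    and J :: "('k, 'b) lmod \<Rightarrow> ('k, 'b) lmod \<Rightarrow> 'k Matrix.mat" and \<phi> :: "'k Matrix.mat"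
  assumes H: "is_hopf_algebra H" and K: "is_hopf_algebra K"
    and lin: "is_linear_fctr (rep_cat H) (rep_cat K) F"
    and equiv: "is_equivalence (rep_cat H) (rep_cat K) F"
    and monoidal: "is_monoidal_structure (rep_cat H) (rep_cat K) F J \<phi>"
begin

abbreviation FO where "FO \<equiv> fobj F"
abbreviation FM where "FM \<equiv> fmor F"
abbreviation HM where "HM \<equiv> is_left_module H"
abbreviation KM where "KM \<equiv> is_left_module K"

lemma fctr: "is_fctr (rep_cat H) (rep_cat K) F"
  using lin by (simp add: is_linear_fctr_def)

lemma F_obj: "HM X \<Longrightarrow> KM (FO X)"
  using functor_obj[OF fctr, of X] by simp

lemma F_hom: "HM X \<Longrightarrow> HM Y \<Longrightarrow> f \<in> module_hom X Y \<Longrightarrow> FM X Y f \<in> module_hom (FO X) (FO Y)"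
  using functor_hom[OF fctr, of X Y f] by simp

lemma F_one: "HM X \<Longrightarrow> FM X X (1\<^sub>m (fst X)) = 1\<^sub>m (fst (FO X))"
  using functor_id[OF fctr, of X] by simp

lemma F_mult: "HM X \<Longrightarrow> HM Y \<Longrightarrow> HM Z \<Longrightarrow> f \<in> module_hom X Y \<Longrightarrow> g \<in> module_hom Y Z \<Longrightarrow>
    FM X Z (g * f) = FM Y Z g * FM X Y f"
  using functor_comp[OF fctr, of X Y Z f g] by simp

lemma F_smult: "HM X \<Longrightarrow> HM Y \<Longrightarrow> f \<in> module_hom X Y \<Longrightarrow> FM X Y (c \<cdot>\<^sub>m f) = c \<cdot>\<^sub>m FM X Y f"
  using lin unfolding is_linear_fctr_def rep_cat_simps by blast

lemma F_faithful: "HM X \<Longrightarrow> HM Y \<Longrightarrow> f \<in> module_hom X Y \<Longrightarrow> g \<in> module_hom X Y \<Longrightarrow> FM X Y f = FM X Y g \<Longrightarrow> f = g"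
  using equivalence_faithful[OF is_category_rep_cat equiv, of X Y f g] by simp

lemma F_full: "HM X \<Longrightarrow> HM Y \<Longrightarrow> h \<in> module_hom (FO X) (FO Y) \<Longrightarrow> \<exists>f\<in>module_hom X Y. FM X Y f = h"
  using equivalence_full[OF is_category_rep_cat is_category_rep_cat equiv, of X Y h] by simp

lemma F_nonzero:
  assumes X: "HM X" and Y: "HM Y" and f: "f \<in> module_hom X Y" and nz: "f \<noteq> 0\<^sub>m (fst Y) (fst X)"
  shows "FM X Y f \<noteq> 0\<^sub>m (fst (FO Y)) (fst (FO X))"
proof
  assume "FM X Y f = 0\<^sub>m (fst (FO Y)) (fst (FO X))"
  then have "0 \<cdot>\<^sub>m FM X Y f = FM X Y f" by simp
  then have "FM X Y (0 \<cdot>\<^sub>m f) = FM X Y f" using F_smult[OF X Y f] by simp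
  moreover have "0 \<cdot>\<^sub>m f \<in> module_hom X Y"
    unfolding zero_smult_mat[OF module_homD(1)[OF f]] by (rule module_hom_zero[OF X Y])
  ultimately have "0 \<cdot>\<^sub>m f = f" using F_faithful[OF X Y _ f] by simp
  then show False using nz zero_smult_mat[OF module_homD(1)[OF f]] by simp
qed

lemma J_iso: "HM X \<Longrightarrow> HM Y \<Longrightarrow>
    is_iso (rep_cat K) (tensor_module K (FO X) (FO Y)) (FO (tensor_module H X Y)) (J X Y)"
  using monoidal unfolding is_monoidal_structure_def rep_cat_simps by blast

lemma \<phi>_iso: "is_iso (rep_cat K) (trivial_module K) (FO (trivial_module H)) \<phi>"
  using monoidal unfolding is_monoidal_structure_def rep_cat_simps by blast

lemma J_natural: "HM X \<Longrightarrow> HM X' \<Longrightarrow> HM Y \<Longrightarrow> HM Y' \<Longrightarrow> f \<in> module_hom X X' \<Longrightarrow> g \<in> module_hom Y Y' \<Longrightarrow>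
    J X' Y' * kron (FM X X' f) (FM Y Y' g) =
      FM (tensor_module H X Y) (tensor_module H X' Y') (kron f g) * J X Y"
  using monoidal unfolding is_monoidal_structure_def rep_cat_simps by blast

lemma J_assoc: "HM X \<Longrightarrow> HM Y \<Longrightarrow> HM Z \<Longrightarrow>
    FM (tensor_module H (tensor_module H X Y) Z) (tensor_module H X (tensor_module H Y Z)) (1\<^sub>m (fst X * fst Y * fst Z)) *
      (J (tensor_module H X Y) Z * kron (J X Y) (1\<^sub>m (fst (FO Z)))) =
    J X (tensor_module H Y Z) * (kron (1\<^sub>m (fst (FO X))) (J Y Z) * 1\<^sub>m (fst (FO X) * fst (FO Y) * fst (FO Z)))"
  using monoidal unfolding is_monoidal_structure_def rep_cat_simps by blast

definition corr :: "('k, 'b) lmod \<Rightarrow> ('k, 'c) lmod \<Rightarrow> bool" where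
  "corr X Z \<longleftrightarrow> HM X \<and> KM Z \<and> isomorphic K (FO X) Z"

lemma corr_F: "HM X \<Longrightarrow> corr X (FO X)"
  by (simp add: corr_def F_obj isomorphic_refl)

lemma corr_surj: "KM Z \<Longrightarrow> \<exists>X. corr X Z"
  using equivalence_surj[OF equiv, of Z] by (auto simp: corr_def isomorphic_def)

lemma corr_trivial: "corr (trivial_module H) (trivial_module K)"
  unfolding corr_def
  using \<phi>_iso isomorphic_sym is_left_module_trivial[OF H] is_left_module_trivial[OF K] isomorphic_def by blast

lemma corr_tensor:
  assumes "corr X Z" "corr Y W"
  shows "corr (tensor_module H X Y) (tensor_module K Z W)"
proof -
  from assms have XY: "HM X" "HM Y" and ZW: "KM Z" "KM W"
    and iso: "isomorphic K (FO X) Z" "isomorphic K (FO Y) W" by (simp_all add: corr_def)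
  have "isomorphic K (FO (tensor_module H X Y)) (tensor_module K (FO X) (FO Y))"
    using J_iso[OF XY] isomorphic_sym isomorphic_def by blast
  moreover have "isomorphic K (tensor_module K (FO X) (FO Y)) (tensor_module K Z W)"
    by (rule isomorphic_tensor) (use XY ZW iso F_obj in auto)
  ultimately have "isomorphic K (FO (tensor_module H X Y)) (tensor_module K Z W)"
    by (rule isomorphic_trans[rotated 3])
      (use XY ZW F_obj is_left_module_tensor[OF H] is_left_module_tensor[OF K] in auto)
  then show ?thesis
    using XY ZW is_left_module_tensor[OF H] is_left_module_tensor[OF K] by (simp add: corr_def)
qed

lemma corr_isomorphic:
  assumes "corr X Z" "corr Y W"
  shows "isomorphic H X Y \<longleftrightarrow> isomorphic K Z W"
proof -
  from assms have XY: "HM X" "HM Y" and ZW: "KM Z" "KM W"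
    and iso: "isomorphic K (FO X) Z" "isomorphic K (FO Y) W" by (simp_all add: corr_def)
  note obj = F_obj[OF XY(1)] F_obj[OF XY(2)]
  have "isomorphic H X Y \<longleftrightarrow> isomorphic K (FO X) (FO Y)"
    using functor_iso[OF fctr, of X Y] equivalence_reflects_iso[OF is_category_rep_cat is_category_rep_cat equiv, of X Y] XY
    unfolding isomorphic_def by auto
  also have "\<dots> \<longleftrightarrow> isomorphic K Z W"
    using iso isomorphic_trans isomorphic_sym obj ZW by metis
  finally show ?thesis .
qed

text \<open>
  Conjugate \<open>h\<close> with the two isomorphisms and lift it along the full functor \<open>F\<close>.
\<close>

lemma corr_nonzero_hom:
  assumes "corr X Z" "corr Y W" and "nonzero_hom Z W"
  shows "nonzero_hom X Y"
proof -
  from assms(1,2) have XY: "HM X" "HM Y" and ZW: "KM Z" "KM W"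
    and iso: "isomorphic K (FO X) Z" "isomorphic K (FO Y) W" by (simp_all add: corr_def)
  note obj = F_obj[OF XY(1)] F_obj[OF XY(2)]
  from iso obtain e d where e: "is_iso (rep_cat K) (FO X) Z e" and "is_iso (rep_cat K) (FO Y) W d"
    by (auto simp: isomorphic_def)
  then obtain d' where d': "is_iso (rep_cat K) W (FO Y) d'" by (metis is_iso_sym)
  from assms(3) obtain h where h: "h \<in> module_hom Z W" "h \<noteq> 0\<^sub>m (fst W) (fst Z)" by (auto simp: nonzero_hom_def)
  have e1: "e \<in> module_hom (FO X) Z" and d1: "d' \<in> module_hom W (FO Y)"
    using e d' by (simp_all add: is_iso_def)
  have he: "h * e \<in> module_hom (FO X) W" by (rule module_hom_comp[OF obj(1) ZW e1 h(1)])
  have "d' * (h * e) \<in> module_hom (FO X) (FO Y)" by (rule module_hom_comp[OF obj(1) ZW(2) obj(2) he d1])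
  from F_full[OF XY this] obtain f where f: "f \<in> module_hom X Y" "FM X Y f = d' * (h * e)" by blast
  have "f \<noteq> 0\<^sub>m (fst Y) (fst X)"
  proof
    assume "f = 0\<^sub>m (fst Y) (fst X)"
    then have "0 \<cdot>\<^sub>m f = f" by simp
    then have "d' * (h * e) = 0 \<cdot>\<^sub>m (d' * (h * e))" using F_smult[OF XY f(1), of 0] f(2) by simp
    also have "\<dots> = 0\<^sub>m (fst (FO Y)) (fst (FO X))"
      by (rule zero_smult_mat) (rule mult_carrier_mat[OF module_homD(1)[OF d1] module_homD(1)[OF he]])
    also have "\<dots> = d' * 0\<^sub>m (fst W) (fst (FO X))"
      by (rule right_mult_zero_mat[OF module_homD(1)[OF d1], symmetric])
    finally have eq: "d' * (h * e) = d' * 0\<^sub>m (fst W) (fst (FO X))" .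
    have "h * e = 0\<^sub>m (fst W) (fst (FO X))"
      using iso_left_cancel[OF is_category_rep_cat _ _ _ d'] ZW obj he module_hom_zero[OF obj(1) ZW(2)] eq by simp
    also have "\<dots> = 0\<^sub>m (fst W) (fst Z) * e" by (rule left_mult_zero_mat[OF module_homD(1)[OF e1], symmetric])
    finally have "h = 0\<^sub>m (fst W) (fst Z)"
      using iso_right_cancel[OF is_category_rep_cat _ _ _ e] ZW obj h(1) module_hom_zero[OF ZW] by simp
    with h(2) show False by simp
  qed
  with f(1) show ?thesis by (auto simp: nonzero_hom_def)
qed

lemma corr_scalar_endomorphisms:
  assumes "corr X Z" and "scalar_endomorphisms Z"
  shows "scalar_endomorphisms X"
  unfolding scalar_endomorphisms_def
proof
  fix f assume f: "f \<in> module_hom X X"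
  from assms(1) have X: "HM X" and Z: "KM Z" and iso: "isomorphic K (FO X) Z" by (simp_all add: corr_def)
  note obj = F_obj[OF X]
  from iso obtain e e' where e: "e \<in> module_hom (FO X) Z" "e' \<in> module_hom Z (FO X)"
    "e' * e = 1\<^sub>m (fst (FO X))" "e * e' = 1\<^sub>m (fst Z)"
    by (auto simp: isomorphic_def is_iso_def)
  note c = module_homD(1)[OF e(1)] module_homD(1)[OF e(2)]
  define h where "h = FM X X f"
  have h: "h \<in> module_hom (FO X) (FO X)" unfolding h_def by (rule F_hom[OF X X f])
  note ch = module_homD(1)[OF h]
  have he': "h * e' \<in> module_hom Z (FO X)" by (rule module_hom_comp[OF Z obj obj e(2) h])
  have "e * (h * e') \<in> module_hom Z Z" by (rule module_hom_comp[OF Z obj Z he' e(1)])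
  then obtain k where k: "e * (h * e') = k \<cdot>\<^sub>m 1\<^sub>m (fst Z)" using assms(2) by (auto simp: scalar_endomorphisms_def)
  have "h = e' * (e * (h * e')) * e"
  proof -
    have "e' * (e * (h * e')) = h * e'"
      using assoc_mult_mat[OF c(2,1) mult_carrier_mat[OF ch c(2)]]
      by (simp add: e(3) left_mult_one_mat[OF mult_carrier_mat[OF ch c(2)]])
    then show ?thesis using assoc_mult_mat[OF ch c(2,1)] by (simp add: e(3) right_mult_one_mat[OF ch])
  qed
  also have "\<dots> = k \<cdot>\<^sub>m 1\<^sub>m (fst (FO X))"
    unfolding k
    by (simp add: mult_smult_distrib[OF c(2) one_carrier_mat] right_mult_one_mat[OF c(2)]
        mult_smult_assoc_mat[OF c(2,1)] e(3))
  also have "\<dots> = FM X X (k \<cdot>\<^sub>m 1\<^sub>m (fst X))"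
    by (simp add: F_smult[OF X X module_hom_one[OF X]] F_one[OF X])
  finally have "FM X X f = FM X X (k \<cdot>\<^sub>m 1\<^sub>m (fst X))" unfolding h_def .
  moreover have "k \<cdot>\<^sub>m 1\<^sub>m (fst X) \<in> module_hom X X"
    using module_carrier[OF X]
    by (simp add: module_hom_def mult_smult_assoc_mat[OF one_carrier_mat module_carrier[OF X]]
        mult_smult_distrib[OF module_carrier[OF X] one_carrier_mat]
        left_mult_one_mat[OF module_carrier[OF X]] right_mult_one_mat[OF module_carrier[OF X]])
  ultimately show "\<exists>k. f = k \<cdot>\<^sub>m 1\<^sub>m (fst X)" using F_faithful[OF X X f] by blast
qed

end

lemma tensor_equivalenceE:
  fixes H :: "('k::field_char_0, 'b::finite) hopf" and K :: "('k, 'c::finite) hopf"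
  assumes "gauge_equivalent H K" "is_hopf_algebra H" "is_hopf_algebra K"
  obtains F J \<phi> where "tensor_equivalence H K F J \<phi>"
  using assms unfolding gauge_equivalent_def tensor_equivalent_def tensor_equivalence_def by blast

section \<open>Objects of order three\<close>

definition has_order_3_object :: "('k::field, 'b::finite) hopf \<Rightarrow> bool" where
  "has_order_3_object H \<longleftrightarrow> (\<exists>X. is_left_module H X \<and>
     isomorphic H (tensor_module H (tensor_module H X X) X) (trivial_module H) \<and>
     \<not> isomorphic H X (trivial_module H))"

lemma (in tensor_equivalence) has_order_3_object_iff: "has_order_3_object H \<longleftrightarrow> has_order_3_object K"
proof -
  have "(isomorphic H (tensor_module H (tensor_module H X X) X) (trivial_module H) \<and> \<not> isomorphic H X (trivial_module H)) \<longleftrightarrow>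
    (isomorphic K (tensor_module K (tensor_module K Z Z) Z) (trivial_module K) \<and> \<not> isomorphic K Z (trivial_module K))"
    if "corr X Z" for X Z
    using corr_isomorphic[OF that corr_trivial]
      corr_isomorphic[OF corr_tensor[OF corr_tensor[OF that that] that] corr_trivial] by blast
  moreover have "HM X \<and> KM Z" if "corr X Z" for X Z using that by (simp add: corr_def)
  ultimately show ?thesis
    unfolding has_order_3_object_def using corr_F corr_surj by meson
qed

lemma (in skew_hopf) has_order_3_objectI:
  assumes "(\<kappa>::'k) ^ 3 = 1" "\<kappa> \<noteq> 1"
  shows "has_order_3_object H"
proof -
  have "\<kappa> ^ 6 = (\<kappa> ^ 3) ^ 2" by (simp flip: power_mult)
  then have "\<kappa> ^ 6 = 1" by (simp add: assms(1))
  then obtain X where X: "is_char H g x X \<kappa>" using char_exists by blast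
  have "is_char H g x (tensor_module H (tensor_module H X X) X) 1"
    using char_tensor[OF char_tensor[OF X X] X] assms(1) by (simp add: power3_eq_cube)
  then have "tensor_module H (tensor_module H X X) X = trivial_module H"
    using char_eqI[OF _ char_trivial] by blast
  then show ?thesis
    unfolding has_order_3_object_def
    using X char_isomorphic_eq[OF X char_trivial] assms(2) is_charD(1)[OF char_trivial]
      isomorphic_refl is_charD(1)[OF X] by metis
qed

text \<open>
  A tensor cube of dimension one forces dimension one. Then \<open>g x = - x g\<close> gives \<open>x = 0\<close> on \<open>X\<close>, hence
  \<open>g\<^sup>2 = 1 - x\<^sup>2 = 1\<close>, which together with \<open>g\<^sup>3 = 1\<close> makes \<open>X\<close> trivial.
\<close>

lemma not_has_order_3_object:
  fixes H :: "('k::field_char_0, 'b::finite) hopf"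
  assumes "is_A1 H g x"
  shows "\<not> has_order_3_object H"
proof
  interpret gx_generated H g x "{fG ^ 6 - 1, fX ^ 2 - (1 - fG ^ 2), fG * fX - (- fX * fG)}"
    using assms by (simp add: gx_generated_def is_A1_def)
  assume "has_order_3_object H"
  then obtain X where X: "is_left_module H X" and
    iso: "isomorphic H (tensor_module H (tensor_module H X X) X) (trivial_module H)" and
    nt: "\<not> isomorphic H X (trivial_module H)"
    by (auto simp: has_order_3_object_def)
  have X1: "fst X = 1" using isomorphic_dim[OF iso] by simp
  note XX = tensor_is_module[OF X X] and T = is_charD[OF char_trivial]
  have c: "snd X a \<in> carrier_mat 1 1" for a using module_carrier[OF X, of a] by (simp add: X1)
  define \<kappa> \<xi> where "\<kappa> = snd X g $$ (0, 0)" and "\<xi> = snd X x $$ (0, 0)"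
  have gx: "snd X g = \<kappa> \<cdot>\<^sub>m 1\<^sub>m 1" "snd X x = \<xi> \<cdot>\<^sub>m 1\<^sub>m 1"
    unfolding \<kappa>_def \<xi>_def by (rule mat_1x1[OF c])+
  note ev = mat_eval_module[OF X, unfolded gx X1]
  have "\<kappa> ^ 6 = 1"
    using relation[OF X, of "fG ^ 6" 1] scalar_mat_1_eq_iff[of "\<kappa> ^ 6" 1]
    by (simp add: X1 ev scalar_mat_power one_smult_mat del: One_nat_def)
  have "(\<kappa> * \<xi>) \<cdot>\<^sub>m 1\<^sub>m 1 = (- 1 * \<xi> * \<kappa>) \<cdot>\<^sub>m (1\<^sub>m 1 :: 'k Matrix.mat)"
    using relation[OF X, of "fG * fX" "scalar (- 1) * fX * fG"]
    by (simp add: X1 ev(1,2,3,6) scalar_mat_mult scalar_minus_one[symmetric] del: One_nat_def)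
      (simp add: scalar_minus_one)
  then have "2 * (\<kappa> * \<xi>) = 0" unfolding scalar_mat_1_eq_iff by (simp add: algebra_simps)
  moreover have "\<kappa> \<noteq> 0" using \<open>\<kappa> ^ 6 = 1\<close> by auto
  ultimately have "\<xi> = 0" by simp
  have "(\<xi> ^ 2) \<cdot>\<^sub>m 1\<^sub>m 1 = 1\<^sub>m 1 - (\<kappa> ^ 2) \<cdot>\<^sub>m (1\<^sub>m 1 :: 'k Matrix.mat)"
    using relation[OF X, of "fX ^ 2" "1 - fG ^ 2"]
    by (simp add: X1 ev mat_eval_diff scalar_mat_power del: One_nat_def)
  then have "((\<xi> ^ 2) \<cdot>\<^sub>m 1\<^sub>m 1) $$ (0, 0) = (1\<^sub>m 1 - (\<kappa> ^ 2) \<cdot>\<^sub>m (1\<^sub>m 1 :: 'k Matrix.mat)) $$ (0, 0)" by simp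
  then have "\<kappa>\<^sup>2 = 1" using \<open>\<xi> = 0\<close> by simp
  have "\<kappa> ^ 3 = 1"
  proof -
    from iso obtain f where f: "is_iso (rep_cat H) (tensor_module H (tensor_module H X X) X) (trivial_module H) f"
      by (auto simp: isomorphic_def)
    then have hom: "f \<in> module_hom (tensor_module H (tensor_module H X X) X) (trivial_module H)"
      by (simp add: is_iso_def)
    have cf: "f \<in> carrier_mat 1 1" using module_homD(1)[OF hom] by (simp add: X1)
    have "snd (tensor_module H (tensor_module H X X) X) g = (\<kappa> ^ 3) \<cdot>\<^sub>m 1\<^sub>m 1"
      by (simp add: tensor_grouplike[OF comult_g XX X] tensor_grouplike[OF comult_g X X] gx
          kron_smult_left kron_smult_right smult_smult_mat power3_eq_cube mult.assoc del: One_nat_def)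
    then have "(\<kappa> ^ 3) \<cdot>\<^sub>m f = 1 \<cdot>\<^sub>m f"
      using module_homD(2)[OF hom, of g] T(3)
      by (simp add: mult_smult_distrib[OF cf one_carrier_mat] mult_smult_assoc_mat[OF one_carrier_mat cf]
          left_mult_one_mat[OF cf] right_mult_one_mat[OF cf] del: One_nat_def)
    then show ?thesis by (rule smult_mat_cancel[OF _ cf one_dim_iso_nonzero[OF f]]) (simp add: X1)
  qed
  have "\<kappa> = 1" using \<open>\<kappa>\<^sup>2 = 1\<close> \<open>\<kappa> ^ 3 = 1\<close> by (simp add: power3_eq_cube power2_eq_square)
  then have "is_char H g x X 1" using X X1 gx \<open>\<xi> = 0\<close> by (simp add: is_char_def one_smult_mat zero_smult_mat[OF one_carrier_mat])
  then have "X = trivial_module H" by (rule char_eqI[OF _ char_trivial])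
  then show False using nt isomorphic_refl[OF X] by simp
qed

section \<open>Invertible objects in the block of the unit object\<close>

text \<open>
  An object with only scalar endomorphisms lies in a single block, so \<open>Q\<close> shows that \<open>X\<close> and the unit
  object are in the same block.
\<close>

definition has_linked_invertible :: "('k::field, 'b::finite) hopf \<Rightarrow> bool" where
  "has_linked_invertible H \<longleftrightarrow> (\<exists>X Y Q. is_left_module H X \<and> is_left_module H Y \<and> is_left_module H Q \<and>
     isomorphic H (tensor_module H X Y) (trivial_module H) \<and>
     \<not> isomorphic H (tensor_module H X X) (trivial_module H) \<and>
     scalar_endomorphisms Q \<and> nonzero_hom X Q \<and> nonzero_hom Q (trivial_module H))"

lemma (in tensor_equivalence) has_linked_invertible_reflect:
  assumes "has_linked_invertible K"
  shows "has_linked_invertible H"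
proof -
  from assms obtain X Y Q where K3: "KM X" "KM Y" "KM Q"
    and inv: "isomorphic K (tensor_module K X Y) (trivial_module K)"
      "\<not> isomorphic K (tensor_module K X X) (trivial_module K)"
    and Q: "scalar_endomorphisms Q" "nonzero_hom X Q" "nonzero_hom Q (trivial_module K)"
    unfolding has_linked_invertible_def by blast
  from K3 obtain X' Y' Q' where c: "corr X' X" "corr Y' Y" "corr Q' Q" using corr_surj by meson
  have "isomorphic H (tensor_module H X' Y') (trivial_module H)"
    "\<not> isomorphic H (tensor_module H X' X') (trivial_module H)"
    using inv corr_isomorphic[OF corr_tensor[OF c(1,2)] corr_trivial]
      corr_isomorphic[OF corr_tensor[OF c(1,1)] corr_trivial] by simp_all
  moreover have "scalar_endomorphisms Q'" by (rule corr_scalar_endomorphisms[OF c(3) Q(1)])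
  moreover have "nonzero_hom X' Q'" by (rule corr_nonzero_hom[OF c(1,3) Q(2)])
  moreover have "nonzero_hom Q' (trivial_module H)" by (rule corr_nonzero_hom[OF c(3) corr_trivial Q(3)])
  ultimately show ?thesis unfolding has_linked_invertible_def using c unfolding corr_def by blast
qed

lemma (in skew_hopf) has_linked_invertibleI:
  assumes "c ^ 2 \<noteq> 1"
  shows "has_linked_invertible H"
proof -
  have "c \<noteq> 1" using assms by auto
  have "(c ^ 5) ^ 6 = (c ^ 6) ^ 5" by (simp flip: power_mult)
  then have "(c ^ 5) ^ 6 = 1" by (simp add: c6)
  with c6 obtain X Y where X: "is_char H g x X c" and Y: "is_char H g x Y (c ^ 5)" using char_exists by meson
  obtain P where P: "is_extension H g x c P" using extension_exists by blast
  have "is_char H g x (tensor_module H X Y) 1"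
    using char_tensor[OF X Y] c6 by (simp add: power_Suc[symmetric] del: power_Suc)
  then have "tensor_module H X Y = trivial_module H" by (rule char_eqI[OF _ char_trivial])
  then have "isomorphic H (tensor_module H X Y) (trivial_module H)"
    using isomorphic_refl is_charD(1)[OF char_trivial] by simp
  moreover have "\<not> isomorphic H (tensor_module H X X) (trivial_module H)"
    using char_isomorphic_eq[OF char_tensor[OF X X] char_trivial] assms by (auto simp: power2_eq_square)
  moreover have "scalar_endomorphisms P"
    unfolding scalar_endomorphisms_def
  proof
    fix f assume f: "f \<in> module_hom P P"
    have "f = f $$ (0, 0) \<cdot>\<^sub>m mat2 1 0 0 1"
      using module_homD(1)[OF f] module_homD(2)[OF f, of g] module_homD(2)[OF f, of x] P \<open>c \<noteq> 1\<close>
      by (intro extension_hom_form[of _ c]) (simp_all add: is_extension_def one_smult_mat)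
    then show "\<exists>k. f = k \<cdot>\<^sub>m 1\<^sub>m (fst P)" using P by (auto simp: is_extension_def mat2_one)
  qed
  moreover have "nonzero_hom X P"
    unfolding nonzero_hom_def using extension_inclusion[OF P X] P is_charD(2)[OF X]
    by (intro bexI[of _ "col2 0 1"]) (auto simp: is_extension_def col2_row2_zero col2_row2_eq_iff simp del: One_nat_def)
  moreover have "nonzero_hom P (trivial_module H)"
    unfolding nonzero_hom_def using extension_projection[OF P char_trivial] P
    by (intro bexI[of _ "row2 1 0"]) (auto simp: is_extension_def col2_row2_zero col2_row2_eq_iff simp del: One_nat_def)
  ultimately show ?thesis
    unfolding has_linked_invertible_def using X Y P unfolding is_char_def is_extension_def by blast
qed

text \<open>
  Since \<open>g\<^sup>2\<close> commutes with \<open>g\<close> and, by \<open>c\<^sup>2 = 1\<close>, with \<open>x\<close>, it acts on \<open>Q\<close> by an endomorphism,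
  hence by a scalar. The nonzero maps from \<open>X\<close> and to the trivial module identify this scalar with the
  value of \<open>g\<^sup>2\<close> on \<open>X\<close> and with \<open>1\<close>; so \<open>X \<otimes> X\<close> is trivial.
\<close>

lemma not_has_linked_invertible:
  fixes H :: "('k::field_char_0, 'b::finite) hopf"
  assumes "skew_hopf H g x c N" and c2: "c ^ 2 = 1"
  shows "\<not> has_linked_invertible H"
proof
  interpret skew_hopf H g x c N by fact
  assume "has_linked_invertible H"
  then obtain X Y Q where X: "is_left_module H X" and Q: "is_left_module H Q"
    and inv: "isomorphic H (tensor_module H X Y) (trivial_module H)"
      "\<not> isomorphic H (tensor_module H X X) (trivial_module H)"
    and end_Q: "scalar_endomorphisms Q" and "nonzero_hom X Q" "nonzero_hom Q (trivial_module H)"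
    unfolding has_linked_invertible_def by blast
  then obtain i p where i: "i \<in> module_hom X Q" "i \<noteq> 0\<^sub>m (fst Q) (fst X)"
    and p: "p \<in> module_hom Q (trivial_module H)" "p \<noteq> 0\<^sub>m 1 (fst Q)"
    by (auto simp: nonzero_hom_def)
  have X1: "fst X = 1" using isomorphic_dim[OF inv(1)] by simp
  obtain \<kappa> where \<kappa>: "is_char H g x X \<kappa>" using char_of_one_dim[OF X X1] by blast
  note G = module_carrier[OF Q, of g] and E = module_carrier[OF Q, of x]
  define M where "M = snd Q g * snd Q g"
  have M: "M \<in> carrier_mat (fst Q) (fst Q)" unfolding M_def by (rule mult_carrier_mat[OF G G])
  have "M * snd Q x = snd Q x * M"
  proof -
    have "M * snd Q x = snd Q g * (c \<cdot>\<^sub>m (snd Q x * snd Q g))"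
      unfolding M_def by (simp add: assoc_mult_mat[OF G G E] g_x_commute[OF Q])
    also have "\<dots> = c \<cdot>\<^sub>m (snd Q g * snd Q x * snd Q g)"
      by (simp add: mult_smult_distrib[OF G mult_carrier_mat[OF E G]] assoc_mult_mat[OF G E G])
    also have "\<dots> = (c * c) \<cdot>\<^sub>m (snd Q x * snd Q g * snd Q g)"
      by (simp add: g_x_commute[OF Q] mult_smult_assoc_mat[OF mult_carrier_mat[OF E G] G] smult_smult_mat)
    also have "\<dots> = snd Q x * M"
      unfolding M_def using c2 by (simp add: power2_eq_square one_smult_mat assoc_mult_mat[OF E G G])
    finally show ?thesis .
  qed
  moreover have "M * snd Q g = snd Q g * M" unfolding M_def by (rule assoc_mult_mat[OF G G G])
  ultimately have "M \<in> module_hom Q Q" using M by (intro module_homI[OF Q Q])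
  then obtain k where k: "M = k \<cdot>\<^sub>m 1\<^sub>m (fst Q)" using end_Q by (auto simp: scalar_endomorphisms_def)
  have Mg: "snd Q (hmult H g g) = k \<cdot>\<^sub>m 1\<^sub>m (fst Q)" using k by (simp add: M_def module_mult[OF Q])
  note ci = module_homD(1)[OF i(1)] and cp = module_homD(1)[OF p(1)]
  have "(\<kappa> * \<kappa>) \<cdot>\<^sub>m i = k \<cdot>\<^sub>m i"
    using module_homD(2)[OF i(1), of "hmult H g g"] is_charD(3)[OF \<kappa>] ci
    by (simp add: Mg module_mult[OF X] scalar_mat_mult X1 mult_smult_distrib[OF _ one_carrier_mat]
        mult_smult_assoc_mat[OF one_carrier_mat] left_mult_one_mat right_mult_one_mat del: One_nat_def)
  then have "\<kappa> * \<kappa> = k" by (rule smult_mat_cancel[OF _ ci i(2)])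
  moreover have "k \<cdot>\<^sub>m p = 1 \<cdot>\<^sub>m p"
    using module_homD(2)[OF p(1), of "hmult H g g"] is_charD(3)[OF char_trivial] cp
    by (simp add: Mg module_mult[OF is_charD(1)[OF char_trivial]] mult_smult_distrib[OF _ one_carrier_mat]
        one_smult_mat left_mult_one_mat right_mult_one_mat del: One_nat_def)
  then have "k = 1" by (rule smult_mat_cancel) (use cp p(2) in simp_all)
  ultimately have "is_char H g x (tensor_module H X X) 1" using char_tensor[OF \<kappa> \<kappa>] by simp
  then have "tensor_module H X X = trivial_module H" by (rule char_eqI[OF _ char_trivial])
  then show False using inv(2) isomorphic_refl[OF is_charD(1)[OF char_trivial]] by simp
qed

section \<open>The half-braiding of a character of order three\<close>

text \<open>
  The commutator \<open>b(v) = j(t,v) / j(v,t)\<close> of a two-cocycle \<open>j\<close> on an abelian group is multiplicative,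
  with denominators cleared. The assumptions are the cocycle equations for the triples \<open>(t,v,w)\<close>,
  \<open>(v,t,w)\<close> and \<open>(v,w,t)\<close>; a variable is named after the two arguments of \<open>j\<close>.
\<close>

lemma commutator_of_cocycle:
  fixes tv_w :: "'k::field"
  assumes "tv_w * t_v = t_vw * v_w" "tv_w * v_t = v_tw * t_w" "vw_t * v_w = v_tw * w_t" and "v_w \<noteq> 0"
  shows "t_vw * v_t * w_t = vw_t * t_v * t_w"
proof -
  have "v_w * (t_vw * v_t * w_t) = (t_vw * v_w) * (v_t * w_t)" by (simp only: ac_simps)
  also have "\<dots> = (tv_w * v_t) * (t_v * w_t)" by (simp only: assms(1)[symmetric] ac_simps)
  also have "\<dots> = (v_tw * w_t) * (t_v * t_w)" by (simp only: assms(2) ac_simps)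
  also have "\<dots> = v_w * (vw_t * t_v * t_w)" by (simp only: assms(3)[symmetric] ac_simps)
  finally have "v_w * (t_vw * v_t * w_t) = v_w * (vw_t * t_v * t_w)" .
  then show ?thesis using assms(4) by simp
qed

context tensor_equivalence
begin

lemma F_dim_tensor: "HM X \<Longrightarrow> HM Y \<Longrightarrow> fst (FO (tensor_module H X Y)) = fst (FO X) * fst (FO Y)"
  using iso_dim_eq[OF J_iso] by simp

lemma J_scalar:
  assumes "HM X" "HM Y" "fst (FO X) = 1" "fst (FO Y) = 1"
  shows "J X Y = J X Y $$ (0, 0) \<cdot>\<^sub>m 1\<^sub>m 1" and "J X Y $$ (0, 0) \<noteq> 0"
proof -
  note iso = J_iso[OF assms(1,2)]
  have c: "J X Y \<in> carrier_mat 1 1"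
    using module_homD(1)[of "J X Y" "tensor_module K (FO X) (FO Y)" "FO (tensor_module H X Y)"] iso
      F_dim_tensor[OF assms(1,2)] by (simp add: is_iso_def assms(3,4))
  then show eq: "J X Y = J X Y $$ (0, 0) \<cdot>\<^sub>m 1\<^sub>m 1" by (rule mat_1x1)
  have "J X Y \<noteq> 0\<^sub>m 1 1" by (rule one_dim_iso_nonzero[OF iso]) (simp add: assms)
  then show "J X Y $$ (0, 0) \<noteq> 0" using eq zero_smult_mat[OF one_carrier_mat, of 1] by auto
qed

text \<open>
  Between one-dimensional objects all constraints are scalars, and the compatibility of the monoidal
  structure with associativity is the cocycle equation.
\<close>

lemma J_cocycle:
  assumes X: "HM X" "fst X = 1" "fst (FO X) = 1" and Y: "HM Y" "fst Y = 1" "fst (FO Y) = 1"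
    and Z: "HM Z" "fst Z = 1" "fst (FO Z) = 1"
    and assoc: "tensor_module H (tensor_module H X Y) Z = tensor_module H X (tensor_module H Y Z)"
  shows "J (tensor_module H X Y) Z $$ (0, 0) * J X Y $$ (0, 0) =
    J X (tensor_module H Y Z) $$ (0, 0) * J Y Z $$ (0, 0)"
proof -
  define W where "W = tensor_module H X (tensor_module H Y Z)"
  have obj: "HM (tensor_module H X Y)" "HM (tensor_module H Y Z)" "HM W"
    unfolding W_def by (intro is_left_module_tensor[OF H] X Y Z)+
  have dims: "fst (FO (tensor_module H X Y)) = 1" "fst (FO (tensor_module H Y Z)) = 1" "fst (FO W) = 1"
    unfolding W_def using X Y Z obj by (simp_all add: F_dim_tensor)
  note s = J_scalar(1)[OF obj(1) Z(1) dims(1) Z(3)] J_scalar(1)[OF X(1) Y(1) X(3) Y(3)]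
    J_scalar(1)[OF X(1) obj(2) X(3) dims(2)] J_scalar(1)[OF Y(1) Z(1) Y(3) Z(3)]
  have FW: "FM W W (1\<^sub>m 1) = 1\<^sub>m 1" using F_one[OF obj(3)] dims by (simp add: W_def X Y Z)
  define a1 a2 a3 a4 where "a1 = J (tensor_module H X Y) Z $$ (0, 0)" and "a2 = J X Y $$ (0, 0)"
    and "a3 = J X (tensor_module H Y Z) $$ (0, 0)" and "a4 = J Y Z $$ (0, 0)"
  note s' = s[folded a1_def a2_def a3_def a4_def]
  have "(a1 * a2) \<cdot>\<^sub>m (1\<^sub>m 1 :: 'k Matrix.mat) = (a3 * a4) \<cdot>\<^sub>m 1\<^sub>m 1"
    using J_assoc[OF X(1) Y(1) Z(1)]
    by (simp add: assoc W_def[symmetric] X Y Z FW s' scalar_mat_mult del: One_nat_def)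
  then show ?thesis unfolding scalar_mat_1_eq_iff a1_def a2_def a3_def a4_def .
qed

lemma F_smult_nonzero:
  assumes X: "HM X" and Y: "HM Y" and f: "f \<in> module_hom X Y" and nz: "f \<noteq> 0\<^sub>m (fst Y) (fst X)"
    and eq: "a \<cdot>\<^sub>m FM X Y f = b \<cdot>\<^sub>m FM X Y f"
  shows "a = b"
  by (rule smult_mat_cancel[OF eq module_homD(1)[OF F_hom[OF X Y f]] F_nonzero[OF X Y f nz]])

end

text \<open>
  Here \<open>t\<close>, \<open>s\<close> and \<open>u\<close> are the characters with values \<open>\<kappa>\<close>, \<open>-1\<close> and \<open>1\<close>, and \<open>j\<close> gives the scalars of
  the monoidal structure between characters. The half-braiding at \<open>V\<close> is the composite of \<open>J t V\<close> with the
  inverse of \<open>J V t\<close>, which can be formed because \<open>F V \<otimes> F t\<close> and \<open>F t \<otimes> F V\<close> are the same module.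
  It is computed at \<open>s\<close> and \<open>u\<close> in two ways, from the cocycle equation and from the module \<open>P\<close>.
\<close>

lemma no_tensor_equivalence_exponents_1_3:
  fixes H :: "('k::field_char_0, 'b::finite) hopf" and K :: "('k, 'c::finite) hopf"
  assumes skew_H: "skew_hopf H g x (- 1) 1" and skew_K: "skew_hopf K h y d 3"
    and E: "tensor_equivalence H K F J \<phi>" and \<kappa>3: "\<kappa> ^ 3 = 1" and \<kappa>1: "(\<kappa> :: 'k) \<noteq> 1"
  shows False
proof -
  interpret H: skew_hopf H g x "- 1" 1 by (rule skew_H)
  interpret K: skew_hopf K h y d 3 by (rule skew_K)
  interpret tensor_equivalence H K F J \<phi> by (rule E)
  have "\<kappa> ^ 6 = (\<kappa> ^ 3) ^ 2" by (simp flip: power_mult)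
  then have "\<kappa> ^ 6 = 1" by (simp add: \<kappa>3)
  then obtain t where t: "is_char H g x t \<kappa>" using H.char_exists by blast
  obtain s where s: "is_char H g x s (- 1)" using H.char_exists[of "- 1"] by auto
  obtain P where P: "is_extension H g x (- 1) P" using H.extension_exists by blast
  define u where "u = trivial_module H"
  have u: "is_char H g x u 1" unfolding u_def by (rule H.char_trivial)
  let ?T = "tensor_module H" and ?TK = "tensor_module K"
  note tD = is_charD[OF t] and sD = is_charD[OF s] and uD = is_charD[OF u]
  have PD: "HM P" "fst P = 2" "snd P g = mat2 1 0 0 (- 1)" "snd P x = mat2 0 0 1 0"
    using P by (simp_all add: is_extension_def)
  have prod: "?T X Y = Z" if "is_char H g x X a" "is_char H g x Y b" "is_char H g x Z (a * b)" for X Y Z a b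
    using H.char_eqI[OF H.char_tensor[OF that(1,2)] that(3)] .
  have ss: "?T s s = u" and uu: "?T u u = u" and ut: "?T u t = t" and tu: "?T t u = t"
    using prod[OF s s, of u] prod[OF u u, of u] prod[OF u t, of t] prod[OF t u, of t] s u t by simp_all
  have st: "?T s t = ?T t s" using prod[OF s t, of "?T t s"] H.char_tensor[OF t s] by (simp add: mult.commute)

  have dim_u: "fst (FO u) = 1" using iso_dim_eq[OF \<phi>_iso] by (simp add: u_def)
  have dim_s: "fst (FO s) = 1" using F_dim_tensor[OF sD(1) sD(1)] dim_u by (simp add: ss)
  have ttt: "?T (?T t t) t = u"
    using H.char_eqI[OF H.char_tensor[OF H.char_tensor[OF t t] t], of u] u \<kappa>3 by (simp add: power3_eq_cube)
  have dim_t: "fst (FO t) = 1"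
    using F_dim_tensor[OF is_left_module_tensor[OF H.hopf tD(1) tD(1)] tD(1)] F_dim_tensor[OF tD(1) tD(1)]
      dim_u by (simp add: ttt)
  obtain \<mu> where \<mu>: "is_char K h y (FO t) \<mu>" using K.char_of_one_dim[OF F_obj[OF tD(1)] dim_t] by blast
  have "\<mu> * \<mu> * \<mu> = 1"
    using char_isomorphic_eq[OF K.char_tensor[OF K.char_tensor[OF \<mu> \<mu>] \<mu>] K.char_trivial]
      corr_isomorphic[OF corr_tensor[OF corr_tensor[OF corr_F corr_F] corr_F] corr_trivial, OF tD(1) tD(1) tD(1)]
      isomorphic_refl[OF uD(1)] by (simp add: ttt u_def)
  then have comm: "?TK V (FO t) = ?TK (FO t) V" if "KM V" for V
    using tensor_commute_char[OF skew_K that \<mu>] by (simp add: power3_eq_cube)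

  \<comment> \<open>The commutator of \<open>j\<close> with \<open>t\<close> is \<open>1\<close> at \<open>u\<close> and a sign at \<open>s\<close>.\<close>
  define j where "j X Y = J X Y $$ (0, 0)" for X Y
  note Jt = J_scalar[folded j_def]
  have comm_j: "j t (?T V W) * j V t * j W t = j (?T V W) t * j t V * j t W"
    if V: "is_char H g x V a" "fst (FO V) = 1" and W: "is_char H g x W b" "fst (FO W) = 1" for V W a b
  proof (rule commutator_of_cocycle)
    note D = is_charD[OF V(1)] is_charD[OF W(1)]
    have assoc: "?T (?T X Y) Z = ?T X (?T Y Z)"
      if "is_char H g x X p" "is_char H g x Y q" "is_char H g x Z r" for X Y Z p q r
      using H.char_eqI[OF H.char_tensor[OF H.char_tensor[OF that(1,2)] that(3)]]
        H.char_tensor[OF that(1) H.char_tensor[OF that(2,3)]] by (simp add: mult.assoc)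
    have Vt: "?T V t = ?T t V" and Wt: "?T W t = ?T t W"
      using prod[OF V(1) t, of "?T t V"] H.char_tensor[OF t V(1)]
        prod[OF W(1) t, of "?T t W"] H.char_tensor[OF t W(1)] by (simp_all add: mult.commute)
    show "j (?T t V) W * j t V = j t (?T V W) * j V W"
      unfolding j_def by (rule J_cocycle[OF tD(1,2) dim_t D(1,2) V(2) D(5,6) W(2) assoc[OF t V(1) W(1)]])
    show "j (?T t V) W * j V t = j V (?T t W) * j t W"
      using J_cocycle[OF D(1,2) V(2) tD(1,2) dim_t D(5,6) W(2) assoc[OF V(1) t W(1)]] by (simp add: j_def Vt)
    show "j (?T V W) t * j V W = j V (?T t W) * j W t"
      using J_cocycle[OF D(1,2) V(2) D(5,6) W(2) tD(1,2) dim_t assoc[OF V(1) W(1) t]] by (simp add: j_def Wt)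
    show "j V W \<noteq> 0" by (rule Jt(2)[OF D(1,5) V(2) W(2)])
  qed
  have nz: "j t u \<noteq> 0" "j u t \<noteq> 0" "j s t \<noteq> 0"
    using Jt(2) tD uD sD dim_t dim_u dim_s by simp_all
  have jtu: "j t u = j u t" using comm_j[OF u dim_u u dim_u] nz by (simp add: uu)
  have jst2: "(j t s)\<^sup>2 = (j s t)\<^sup>2"
    using comm_j[OF s dim_s s dim_s] nz by (simp add: ss jtu power2_eq_square)

  \<comment> \<open>The half-braiding at \<open>P\<close> is \<open>F f\<close> for a module map \<open>f = k \<beta>\<close>.\<close>
  have obj: "HM (?T P t)" "HM (?T t P)" "HM (?T t s)" by (intro is_left_module_tensor[OF H.hopf] tD sD PD)+
  have \<kappa>0: "\<kappa> \<noteq> 0" using \<kappa>3 by auto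
  have Pt: "fst (?T P t) = 2" "snd (?T P t) g = \<kappa> \<cdot>\<^sub>m mat2 1 0 0 (- 1)" "snd (?T P t) x = mat2 0 0 1 0"
    and tP: "fst (?T t P) = 2" "snd (?T t P) g = \<kappa> \<cdot>\<^sub>m mat2 1 0 0 (- 1)" "snd (?T t P) x = \<kappa> \<cdot>\<^sub>m mat2 0 0 1 0"
    by (simp_all add: PD tD tensor_grouplike[OF H.comult_g PD(1) tD(1)] tensor_grouplike[OF H.comult_g tD(1) PD(1)]
        H.tensor_x[OF PD(1) tD(1)] H.tensor_x[OF tD(1) PD(1)] kron_smult_left kron_smult_right
        kron_scalar_left[OF zero_carrier_mat] kron_scalar_right[OF zero_carrier_mat] scalar_mat_power
        mat2_one mat2_zero mat2_smult mat2_add mat2_diag_power del: One_nat_def)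
  define \<beta> where "\<beta> = mat2 1 0 0 \<kappa>"
  have \<beta>: "\<beta> \<in> module_hom (?T P t) (?T t P)"
    by (rule H.module_homI[OF obj(1,2)]) (simp_all add: \<beta>_def Pt tP mat2_mult mat2_smult PD tD)
  note JPt = J_iso[OF PD(1) tD(1)] and JtP = J_iso[OF tD(1) PD(1)]
  from JPt obtain J' where J': "J' \<in> module_hom (FO (?T P t)) (?TK (FO P) (FO t))"
    "J' * J P t = 1\<^sub>m (fst (FO P) * fst (FO t))" by (auto simp: is_iso_def)
  have homPt: "J P t \<in> module_hom (?TK (FO P) (FO t)) (FO (?T P t))"
    and homtP: "J t P \<in> module_hom (?TK (FO P) (FO t)) (FO (?T t P))"
    using JPt JtP comm[OF F_obj[OF PD(1)]] by (simp_all add: is_iso_def)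
  define h' where "h' = J t P * J'"
  have h': "h' \<in> module_hom (FO (?T P t)) (FO (?T t P))"
    unfolding h'_def
    by (rule module_hom_comp[OF F_obj[OF obj(1)] is_left_module_tensor[OF K.hopf F_obj[OF PD(1)] F_obj[OF tD(1)]]
          F_obj[OF obj(2)] J'(1) homtP])
  have h'J: "h' * J P t = J t P"
  proof -
    note c = module_homD(1)[OF homtP] module_homD(1)[OF J'(1)] module_homD(1)[OF homPt]
    have "h' * J P t = J t P * (J' * J P t)" unfolding h'_def by (rule assoc_mult_mat[OF c])
    then show ?thesis using right_mult_one_mat[OF c(1)] by (simp add: J'(2))
  qed
  from F_full[OF obj(1,2) h'] obtain f where f: "f \<in> module_hom (?T P t) (?T t P)" "FM (?T P t) (?T t P) f = h'"
    by blast
  obtain k where fk: "f = k \<cdot>\<^sub>m \<beta>"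
  proof -
    have cf: "f \<in> carrier_mat 2 2" using module_homD(1)[OF f(1)] by (simp add: Pt tP del: fst_tensor_module)
    have "\<kappa> \<cdot>\<^sub>m (f * mat2 1 0 0 (- 1)) = \<kappa> \<cdot>\<^sub>m (mat2 1 0 0 (- 1) * f)"
      using module_homD(2)[OF f(1), of g]
      by (simp add: Pt tP mult_smult_distrib[OF cf mat2_carrier] mult_smult_assoc_mat[OF mat2_carrier cf])
    then have "inverse \<kappa> \<cdot>\<^sub>m (\<kappa> \<cdot>\<^sub>m (f * mat2 1 0 0 (- 1))) = inverse \<kappa> \<cdot>\<^sub>m (\<kappa> \<cdot>\<^sub>m (mat2 1 0 0 (- 1) * f))" by simp
    then have "f * mat2 1 0 0 (- 1) = mat2 1 0 0 (- 1) * f" using \<kappa>0 by (simp add: smult_smult_mat one_smult_mat)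
    moreover have "f * mat2 0 0 1 0 = (\<kappa> \<cdot>\<^sub>m mat2 0 0 1 0) * f"
      using module_homD(2)[OF f(1), of x] by (simp only: Pt tP)
    ultimately have "f = f $$ (0, 0) \<cdot>\<^sub>m \<beta>"
      unfolding \<beta>_def by (intro extension_hom_form[OF cf, of "- 1"]) simp_all
    then show ?thesis by (rule that)
  qed
  define B where "B = FM (?T P t) (?T t P) \<beta>"
  have h'B: "h' = k \<cdot>\<^sub>m B" using F_smult[OF obj(1,2) \<beta>] f(2) by (simp add: fk B_def)
  have B: "B \<in> carrier_mat (fst (FO (?T t P))) (fst (FO (?T P t)))"
    unfolding B_def by (rule module_homD(1)[OF F_hom[OF obj(1,2) \<beta>]])
  have F1: "FM t t (1\<^sub>m 1) = 1\<^sub>m 1" using F_one[OF tD(1)] by (simp add: tD dim_t)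
  have one_t: "1\<^sub>m 1 \<in> module_hom t t" using module_hom_one[OF tD(1)] by (simp add: tD)
  note hPt = homPt[THEN module_homD(1)] and htP = homtP[THEN module_homD(1)]

  \<comment> \<open>Naturality along the projection of \<open>P\<close> to \<open>u\<close> determines the factor \<open>k\<close>.\<close>
  define p :: "'k Matrix.mat" where "p = row2 1 0"
  have p: "p \<in> module_hom P u" unfolding p_def by (rule H.extension_projection[OF P u])
  have pPt: "p \<in> module_hom (?T P t) t" and ptP: "p \<in> module_hom (?T t P) t"
    using kron_module_hom[OF PD(1) tD(1) uD(1) tD(1) p one_t] kron_module_hom[OF tD(1) PD(1) tD(1) uD(1) one_t p]
    by (simp_all add: ut tu del: One_nat_def)
  define Fp where "Fp = FM P u p"
  have cFp: "Fp \<in> carrier_mat 1 (fst (FO P))"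
    using module_homD(1)[OF F_hom[OF PD(1) uD(1) p]] by (simp add: Fp_def dim_u)
  have nat_p: "j u t \<cdot>\<^sub>m Fp = FM (?T P t) t p * J P t" "j t u \<cdot>\<^sub>m Fp = FM (?T t P) t p * J t P"
    using J_natural[OF PD(1) uD(1) tD(1) tD(1) p one_t] J_natural[OF tD(1) tD(1) PD(1) uD(1) one_t p]
    by (simp_all add: F1 ut tu Fp_def[symmetric] Jt(1)[OF uD(1) tD(1) dim_u dim_t] Jt(1)[OF tD(1) uD(1) dim_t dim_u]
        mult_smult_assoc_mat[OF one_carrier_mat cFp] left_mult_one_mat[OF cFp] del: One_nat_def)
  have pB: "FM (?T t P) t p * B = FM (?T P t) t p"
    using F_mult[OF obj(1,2) tD(1) \<beta> ptP] by (simp add: B_def) (simp add: p_def \<beta>_def row2_mat2)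
  have "j t u \<cdot>\<^sub>m Fp = (k * j u t) \<cdot>\<^sub>m Fp"
  proof -
    note c = module_homD(1)[OF F_hom[OF obj(2) tD(1) ptP]]
    have "j t u \<cdot>\<^sub>m Fp = FM (?T t P) t p * (k \<cdot>\<^sub>m (B * J P t))"
      by (simp only: nat_p h'J[symmetric] h'B mult_smult_assoc_mat[OF B hPt])
    also have "\<dots> = k \<cdot>\<^sub>m (FM (?T t P) t p * B * J P t)"
      by (simp only: mult_smult_distrib[OF c mult_carrier_mat[OF B hPt]] assoc_mult_mat[OF c B hPt])
    also have "\<dots> = (k * j u t) \<cdot>\<^sub>m Fp" by (simp only: pB nat_p[symmetric] smult_smult_mat)
    finally show ?thesis .
  qed
  then have "k = 1" using F_smult_nonzero[OF PD(1) uD(1) p, of "j t u" "k * j u t"] nz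
    by (simp add: Fp_def jtu p_def PD uD col2_row2_zero col2_row2_eq_iff del: One_nat_def)

  \<comment> \<open>Naturality along the inclusion of \<open>s\<close> into \<open>P\<close>, on whose image \<open>\<beta>\<close> is \<open>\<kappa>\<close>.\<close>
  define i :: "'k Matrix.mat" where "i = col2 0 1"
  have i: "i \<in> module_hom s P" unfolding i_def by (rule H.extension_inclusion[OF P s])
  have iPt: "i \<in> module_hom (?T t s) (?T P t)" and itP: "i \<in> module_hom (?T t s) (?T t P)"
    using kron_module_hom[OF sD(1) tD(1) PD(1) tD(1) i one_t] kron_module_hom[OF tD(1) sD(1) tD(1) PD(1) one_t i]
    by (simp_all add: st del: One_nat_def)
  have "j t s \<cdot>\<^sub>m FM (?T t s) (?T t P) i = (\<kappa> * j s t) \<cdot>\<^sub>m FM (?T t s) (?T t P) i"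
  proof -
    define Fi where "Fi = FM s P i"
    have cFi: "Fi \<in> carrier_mat (fst (FO P)) 1"
      using module_homD(1)[OF F_hom[OF sD(1) PD(1) i]] by (simp add: Fi_def dim_s)
    have dim_ts: "fst (FO (?T t s)) = 1" using F_dim_tensor[OF tD(1) sD(1)] by (simp add: dim_t dim_s)
    note c = module_homD(1)[OF F_hom[OF obj(3,1) iPt], unfolded dim_ts]
      module_homD(1)[OF F_hom[OF obj(3,2) itP], unfolded dim_ts]
    have nat_i: "J P t * Fi = j s t \<cdot>\<^sub>m FM (?T t s) (?T P t) i" "J t P * Fi = j t s \<cdot>\<^sub>m FM (?T t s) (?T t P) i"
      using J_natural[OF sD(1) PD(1) tD(1) tD(1) i one_t] J_natural[OF tD(1) tD(1) sD(1) PD(1) one_t i]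
      by (simp_all add: F1 st Fi_def[symmetric] Jt(1)[OF sD(1) tD(1) dim_s dim_t] Jt(1)[OF tD(1) sD(1) dim_t dim_s]
          mult_smult_distrib[OF c(1) one_carrier_mat] mult_smult_distrib[OF c(2) one_carrier_mat]
          right_mult_one_mat[OF c(1)] right_mult_one_mat[OF c(2)] del: One_nat_def)
    have "B * FM (?T t s) (?T P t) i = FM (?T t s) (?T t P) (\<beta> * i)"
      using F_mult[OF obj(3,1,2) iPt \<beta>] by (simp add: B_def)
    also have "\<beta> * i = \<kappa> \<cdot>\<^sub>m i" by (simp add: \<beta>_def i_def mat2_col2 col2_row2_smult)
    also have "FM (?T t s) (?T t P) (\<kappa> \<cdot>\<^sub>m i) = \<kappa> \<cdot>\<^sub>m FM (?T t s) (?T t P) i"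
      by (rule F_smult[OF obj(3,2) itP])
    finally have Bi: "B * FM (?T t s) (?T P t) i = \<kappa> \<cdot>\<^sub>m FM (?T t s) (?T t P) i" .
    have cFi': "Fi \<in> carrier_mat (fst (?TK (FO P) (FO t))) 1" using cFi by (simp add: dim_t)
    have "j t s \<cdot>\<^sub>m FM (?T t s) (?T t P) i = B * J P t * Fi"
      by (simp only: nat_i(2)[symmetric] h'J[symmetric] h'B \<open>k = 1\<close> one_smult_mat)
    also have "\<dots> = B * (j s t \<cdot>\<^sub>m FM (?T t s) (?T P t) i)"
      by (simp only: assoc_mult_mat[OF B hPt cFi'] nat_i(1))
    also have "\<dots> = (\<kappa> * j s t) \<cdot>\<^sub>m FM (?T t s) (?T t P) i"
      by (simp only: mult_smult_distrib[OF B c(1)] Bi smult_smult_mat mult.commute)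
    finally show ?thesis .
  qed
  then have "j t s = \<kappa> * j s t"
    by (rule F_smult_nonzero[OF obj(3,2) itP, rotated])
      (simp add: i_def tD sD PD col2_row2_zero col2_row2_eq_iff del: One_nat_def)
  then have "\<kappa>\<^sup>2 = 1" using jst2 nz by (simp add: power_mult_distrib)
  then show False using \<kappa>3 \<kappa>1 by (simp add: power3_eq_cube power2_eq_square)
qed

section \<open>The four algebras\<close>

theorem mainTheorem3:
  fixes \<omega> :: "'k::{alg_closed_field, field_char_0}"
    and A0 :: "('k, 'a0::finite) hopf" and A1 :: "('k, 'a1::finite) hopf"
    and B0 :: "('k, 'b0::finite) hopf" and B1 :: "('k, 'b1::finite) hopf"
  assumes "primitive_root_of_unity 6 \<omega>"
    and "is_A0 A0 g0 x0" and "is_A1 A1 g1 x1"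
    and "is_B0 B0 h0 y0" and "is_B1 \<omega> B1 h1 y1"
  shows "\<not> gauge_equivalent A0 A1 \<and> \<not> gauge_equivalent A0 B0 \<and> \<not> gauge_equivalent A0 B1 \<and>
         \<not> gauge_equivalent A1 B0 \<and> \<not> gauge_equivalent A1 B1 \<and> \<not> gauge_equivalent B0 B1"
proof -
  have \<omega>: "\<omega> ^ 6 = 1" "\<omega> ^ 2 \<noteq> 1" using assms(1) by (simp_all add: primitive_root_of_unity_def)
  have \<omega>3: "(\<omega> ^ 2) ^ 3 = 1" using \<omega>(1) by (simp flip: power_mult)
  note skew = skew_hopf_of_A0[OF assms(2)] skew_hopf_of_B0[OF assms(4)] skew_hopf_of_B1[OF assms(5) \<omega>(1)]
  have hopf: "is_hopf_algebra A0" "is_hopf_algebra A1" "is_hopf_algebra B0" "is_hopf_algebra B1"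
    using assms(2-5) by (simp_all add: is_A0_def is_A1_def is_B0_def is_B1_def gx_hopf_def)
  note order3 = skew[THEN skew_hopf.has_order_3_objectI, OF \<omega>3 \<omega>(2)] not_has_order_3_object[OF assms(3)]
  note linked = skew(1,2)[THEN not_has_linked_invertible] skew_hopf.has_linked_invertibleI[OF skew(3) \<omega>(2)]
  have "\<not> gauge_equivalent A0 A1"
    using order3 tensor_equivalence.has_order_3_object_iff[where H = A0 and K = A1] hopf tensor_equivalenceE by metis
  moreover have "\<not> gauge_equivalent A1 B0"
    using order3 tensor_equivalence.has_order_3_object_iff[where H = A1 and K = B0] hopf tensor_equivalenceE by metis
  moreover have "\<not> gauge_equivalent A1 B1"
    using order3 tensor_equivalence.has_order_3_object_iff[where H = A1 and K = B1] hopf tensor_equivalenceE by metis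
  moreover have "\<not> gauge_equivalent A0 B1"
    using linked tensor_equivalence.has_linked_invertible_reflect[where H = A0 and K = B1] hopf tensor_equivalenceE
    by (metis power2_minus one_power2)
  moreover have "\<not> gauge_equivalent B0 B1"
    using linked tensor_equivalence.has_linked_invertible_reflect[where H = B0 and K = B1] hopf tensor_equivalenceE
    by (metis power2_minus one_power2)
  moreover have "\<not> gauge_equivalent A0 B0"
    using no_tensor_equivalence_exponents_1_3[OF skew(1,2) _ \<omega>3 \<omega>(2)] hopf tensor_equivalenceE by metis
  ultimately show ?thesis by blast
qed

end
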